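(* Let $d\ge 2$ and let $F:\mathbb{R}^d\to\mathbb{R}$ be a continuous centred stationary Gaussian field whose spectral measure $\rho$ satisfies $(\rho1)$–$(\rho4)$. Let $\Psi_F$ be the limit volume distribution of $F$ and let $\mathcal{P}=\mathcal{P}^F$ be the percolation probability associated to $F$. Then: (a) The mean of the limit volume distribution $\Psi_F$ is $$\int_0^\infty (1-\Psi_F(t))\,dt=(1-\mathcal{P})\cdot\frac{1}{c_{NS}(\rho)}.$$ (b) If $F$ moreover satisfies the nodal lower concentration property, then the empirical volume mean converges to $1/c_{NS}(\rho)$ in mean, i.e. $$\lim_{R\to\infty}\mathbb{E}\left[\left|\frac{\operatorname{Vol}B(R)}{\mathcal{N}(F;R)}\cdot\mathbf{1}_{\mathcal{N}(F;R)>0}-\frac{1}{c_{NS}(\rho)}\right|\right]=0.$$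
   Context: Spectral measure: for a continuous centred stationary Gaussian field $F$ on $\mathbb{R}^d$ with covariance $r_F(x-y)=\mathbb{E}[F(x)F(y)]$, the spectral measure $\rho$ is the Fourier transform of $r_F$, normalised to be a probability measure (i.e. $r_F(0)=1$). Axioms: $(\rho1)$ $\rho$ has no atoms. $(\rho2)$ For some $p>6$, $\int_{\mathbb{R}^d}\|\lambda\|^p\,d\rho(\lambda)<\infty$. $(\rho3)$ The support of $\rho$ does not lie in a hyperplane of $\mathbb{R}^d$. $(\rho4)$ $c_{NS}(\rho)>0$, where $c_{NS}(\rho)$ is defined below. Nodal domains: the nodal set is $\mathcal{A}(F)=F^{-1}(0)$ and a nodal domain is a connected component of $\mathbb{R}^d\setminus\mathcal{A}(F)$. Let $B(R)\subseteq\mathbb{R}^d$ be the ball of radius $R$ centred at the origin; $\mathcal{N}(F;R)$ is the number of nodal domains of $F$ lying entirely in $B(R)$, and for $t>0$, $\mathcal{N}(F,t;R)$ is the number of those of volume $<t$. Under $(\rho2)$–$(\rho3)$ the Nazarov–Sodin constant $c_{NS}(\rho)=\lim_{R\to\infty}\mathbb{E}[\mathcal{N}(F;R)]/\operatorname{Vol}B(R)\ge0$ exists, and under $(\rho1)$–$(\rho3)$ also $\mathbb{E}[|\mathcal{N}(F;R)/\operatorname{Vol}B(R)-c_{NS}(\rho)|]\to0$ as $R\to\infty$ (Nazarov–Sodin). Limit volume distribution: under $(\rho1)$–$(\rho4)$ there exists (by a known theorem of Beliaev–Wigman) a deterministic cumulative distribution function $\Psi_F:\mathbb{R}_{>0}\to[0,1]$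 such that for all continuity points $t$ of $\Psi_F$, $\mathbb{E}\left[\left|\frac{\mathcal{N}(F,t;R)}{c_{NS}(\rho)\operatorname{Vol}B(R)}-\Psi_F(t)\right|\right]\to0$ as $R\to\infty$. Percolation probability: $\mathcal{P}^F$ is the probability that the origin is contained in an unbounded nodal domain of $F$; equivalently, $\mathcal{P}^F=\lim_{R\to\infty}\Pr(\text{the origin is contained in a nodal domain of }F\text{ intersecting }\partial[-R,R]^d)$. Nodal lower concentration property: $F$ satisfies it if, for every $\epsilon>0$, $\Pr\left(\frac{\mathcal{N}(F;R)}{\operatorname{Vol}B(R)}<c_{NS}(\rho)-\epsilon\right)=o(R^{-d})$ as $R\to\infty$. *)

theory Defs
  imports "HOL-Probability.Probability" "HOL-Library.Landau_Symbols"
begin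

section \<open>Continuous centred stationary Gaussian fields\<close>

text \<open>A random field on a Euclidean space is a map \<open>F\<close> with \<open>F x \<omega>\<close> the value at the point \<open>x\<close>;
  its sample paths are the functions \<open>\<lambda>x. F x \<omega>\<close>.\<close>

text \<open>The degenerate law (point mass at zero) counts as centred Gaussian; it occurs for
  linear combinations of field values.\<close>

definition centred_gaussian :: "'w measure \<Rightarrow> ('w \<Rightarrow> real) \<Rightarrow> bool" where
  "centred_gaussian M X \<longleftrightarrow> X \<in> borel_measurable M \<and>
     ((AE \<omega> in M. X \<omega> = 0) \<or> (\<exists>\<sigma>>0. distributed M lborel X (normal_density 0 \<sigma>)))"

definition centred_gaussian_field ::
    "'w measure \<Rightarrow> ('a::euclidean_space \<Rightarrow> 'w \<Rightarrow> real) \<Rightarrow> bool" where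
  "centred_gaussian_field M F \<longleftrightarrow>
     (\<forall>S a. finite S \<longrightarrow> centred_gaussian M (\<lambda>\<omega>. \<Sum>x\<in>S. a x * F x \<omega>))"

definition stationary_field ::
    "'w measure \<Rightarrow> ('a::euclidean_space \<Rightarrow> 'w \<Rightarrow> real) \<Rightarrow> bool" where
  "stationary_field M F \<longleftrightarrow>
     (\<forall>S h. finite S \<longrightarrow>
        distr M (\<Pi>\<^sub>M x\<in>S. borel) (\<lambda>\<omega>. \<lambda>x\<in>S. F (x + h) \<omega>) =
        distr M (\<Pi>\<^sub>M x\<in>S. borel) (\<lambda>\<omega>. \<lambda>x\<in>S. F x \<omega>))"

definition continuous_field ::
    "'w measure \<Rightarrow> ('a::euclidean_space \<Rightarrow> 'w \<Rightarrow> real) \<Rightarrow> bool" where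
  "continuous_field M F \<longleftrightarrow> (\<forall>\<omega>\<in>space M. continuous_on UNIV (\<lambda>x. F x \<omega>))"

section \<open>Spectral measure\<close>

text \<open>The convention for the Fourier transform is \<open>r\<^sub>F(z) = \<integral> e\<^sup>2\<^sup>\<pi>\<^sup>i\<^sup>z\<^sup>\<lambda> d\<rho>(\<lambda>)\<close>. Since \<open>\<rho>\<close> is a probability
  measure, \<open>x = y\<close> gives the normalisation \<open>r\<^sub>F(0) = 1\<close>.\<close>

definition spectral_measure ::
    "'w measure \<Rightarrow> ('a::euclidean_space \<Rightarrow> 'w \<Rightarrow> real) \<Rightarrow> 'a measure \<Rightarrow> bool" where
  "spectral_measure M F \<rho> \<longleftrightarrow> prob_space \<rho> \<and> sets \<rho> = sets borel \<and>
     (\<forall>x y. complex_of_real (LINT \<omega>|M. F x \<omega> * F y \<omega>) =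
            (LINT l|\<rho>. iexp (2 * pi * (l \<bullet> (x - y)))))"

definition measure_support :: "'a::topological_space measure \<Rightarrow> 'a set" where
  "measure_support \<mu> = {x. \<forall>U. open U \<and> x \<in> U \<longrightarrow> emeasure \<mu> U > 0}"

definition rho1 :: "'a::euclidean_space measure \<Rightarrow> bool" where
  "rho1 \<rho> \<longleftrightarrow> (\<forall>x. emeasure \<rho> {x} = 0)"

definition rho2 :: "'a::euclidean_space measure \<Rightarrow> bool" where
  "rho2 \<rho> \<longleftrightarrow> (\<exists>p>6. integrable \<rho> (\<lambda>l. norm l powr p))"

definition rho3 :: "'a::euclidean_space measure \<Rightarrow> bool" where
  "rho3 \<rho> \<longleftrightarrow> \<not> (\<exists>a b. a \<noteq> 0 \<and> measure_support \<rho> \<subseteq> {x. a \<bullet> x = b})"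

section \<open>Nodal domains and their counts\<close>

definition nodal_set :: "('a::euclidean_space \<Rightarrow> real) \<Rightarrow> 'a set" where
  "nodal_set f = f -` {0}"

definition nodal_domains :: "('a::euclidean_space \<Rightarrow> real) \<Rightarrow> 'a set set" where
  "nodal_domains f = components (- nodal_set f)"

text \<open>The counts are cardinalities with values in \<open>[0,\<infinity>]\<close>, so that infinitely many
  domains count as \<open>\<infinity>\<close> (and not as \<open>0\<close>, as with \<^const>\<open>card\<close>).\<close>

definition nodal_count :: "('a::euclidean_space \<Rightarrow> real) \<Rightarrow> real \<Rightarrow> ennreal" where
  "nodal_count f R =
     emeasure (count_space UNIV) {D \<in> nodal_domains f. D \<subseteq> ball 0 R}"

definition nodal_count_vol :: "('a::euclidean_space \<Rightarrow> real) \<Rightarrow> real \<Rightarrow> real \<Rightarrow> ennreal" where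
  "nodal_count_vol f t R =
     emeasure (count_space UNIV)
       {D \<in> nodal_domains f. D \<subseteq> ball 0 R \<and> measure lborel D < t}"

text \<open>\<open>E|X - a|\<close> for \<open>[0,\<infinity>]\<close>-valued \<open>X\<close>. The difference is formed in \<^typ>\<open>ereal\<close> because subtraction
  on \<^typ>\<open>ennreal\<close> truncates; where \<open>X\<close> is infinite, the distance is infinite.\<close>

definition mean_abs_diff :: "'w measure \<Rightarrow> ('w \<Rightarrow> ennreal) \<Rightarrow> real \<Rightarrow> ennreal" where
  "mean_abs_diff M X a = (\<integral>\<^sup>+\<omega>. e2ennreal \<bar>enn2ereal (X \<omega>) - ereal a\<bar> \<partial>M)"

section \<open>Asymptotic quantities\<close>

definition nazarov_sodin_constant ::
    "'w measure \<Rightarrow> ('a::euclidean_space \<Rightarrow> 'w \<Rightarrow> real) \<Rightarrow> real \<Rightarrow> bool" where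
  "nazarov_sodin_constant M F c \<longleftrightarrow> c \<ge> 0 \<and>
     ((\<lambda>R. (\<integral>\<^sup>+\<omega>. nodal_count (\<lambda>x. F x \<omega>) R \<partial>M) / ennreal (measure lborel (ball (0::'a) R)))
        \<longlongrightarrow> ennreal c) at_top"

text \<open>\<open>\<Psi>\<close> is the restriction to \<open>(0,\<infinity>)\<close> of the distribution function of a law on \<open>(0,\<infinity>)\<close>;
  its values elsewhere are irrelevant.\<close>

definition positive_cdf :: "(real \<Rightarrow> real) \<Rightarrow> bool" where
  "positive_cdf \<Psi> \<longleftrightarrow>
     (\<exists>\<mu>. real_distribution \<mu> \<and> measure \<mu> {..0} = 0 \<and> (\<forall>t>0. \<Psi> t = cdf \<mu> t))"

text \<open>The argument \<open>c\<close> is the Nazarov--Sodin constant. The defining property determines \<open>\<Psi>\<close> at its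
  continuity points, hence, by right-continuity, on \<open>(0,\<infinity>)\<close>.\<close>

definition limit_volume_distribution ::
    "'w measure \<Rightarrow> ('a::euclidean_space \<Rightarrow> 'w \<Rightarrow> real) \<Rightarrow> real \<Rightarrow> (real \<Rightarrow> real) \<Rightarrow> bool" where
  "limit_volume_distribution M F c \<Psi> \<longleftrightarrow> positive_cdf \<Psi> \<and>
     (\<forall>t>0. isCont \<Psi> t \<longrightarrow>
        ((\<lambda>R. mean_abs_diff M
                (\<lambda>\<omega>. nodal_count_vol (\<lambda>x. F x \<omega>) t R / ennreal (c * measure lborel (ball (0::'a) R)))
                (\<Psi> t)) \<longlongrightarrow> 0) at_top)"

definition percolation_probability ::
    "'w measure \<Rightarrow> ('a::euclidean_space \<Rightarrow> 'w \<Rightarrow> real) \<Rightarrow> real" where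
  "percolation_probability M F =
     measure M {\<omega> \<in> space M. \<exists>D \<in> nodal_domains (\<lambda>x. F x \<omega>). 0 \<in> D \<and> \<not> bounded D}"

definition nodal_lower_concentration ::
    "'w measure \<Rightarrow> ('a::euclidean_space \<Rightarrow> 'w \<Rightarrow> real) \<Rightarrow> real \<Rightarrow> bool" where
  "nodal_lower_concentration M F c \<longleftrightarrow>
     (\<forall>\<epsilon>>0. (\<lambda>R. measure M {\<omega> \<in> space M.
               enn2ereal (nodal_count (\<lambda>x. F x \<omega>) R / ennreal (measure lborel (ball (0::'a) R)))
                 < ereal (c - \<epsilon>)})
            \<in> o[at_top](\<lambda>R. R powr (- real DIM('a))))"

end

theory Submission
  imports Defs
begin

text \<open>
  Every nodal domain \<open>D\<close> in \<open>B(R)\<close> satisfies \<open>min (vol D) T = \<integral>\<^sub>0\<^sup>T 1[t \<le> vol D] dt\<close>, so the expected sum of the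
  truncated volumes is \<open>\<integral>\<^sub>0\<^sup>T E[N(R) - N(t;R)] dt\<close>; after division by \<open>c vol B(R)\<close> it tends to
  \<open>\<integral>\<^sub>0\<^sup>T (1 - \<Psi>)\<close> by dominated convergence. On the other hand a sum of volumes is an integral over
  points, and by stationarity its mean is at most \<open>vol B(R)\<close> times the probability that the domain of the
  origin is bounded, and at least \<open>vol B(R - L)\<close> times the probability that this domain lies in \<open>B(L)\<close>,
  provided \<open>T \<ge> vol B(L)\<close>. Letting \<open>R\<close> and then \<open>L\<close> tend to infinity gives (a).

  For (b), \<open>N(R) - N(t;R) \<ge> 0\<close> has normalised mean tending to \<open>1 - \<Psi>(t)\<close>, which is small for large \<open>t\<close>;
  hence \<open>N(R) / vol B(R) \<rightarrow> c\<close> in mean. Where this ratio is at least \<open>c/2\<close>, inversion is Lipschitz; elsewhere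
  the empirical mean is at most \<open>vol B(R)\<close>, and the concentration hypothesis makes that event have
  probability \<open>o(R\<^sup>-\<^sup>d)\<close>.
\<close>

section \<open>Nodal domains through countably many field values\<close>

abbreviation cell :: "('a::euclidean_space \<Rightarrow> real) \<Rightarrow> 'a \<Rightarrow> 'a set" where
  "cell f x \<equiv> connected_component_set (- nodal_set f) x"

text \<open>One fixed sequence serves all functions and all sample points at once. Repetitions are
  harmless, since later only the first index in each domain is selected.\<close>

definition dense_seq :: "nat \<Rightarrow> 'a::euclidean_space" where
  "dense_seq = (SOME s. \<forall>X. open X \<longrightarrow> X \<noteq> {} \<longrightarrow> (\<exists>n. s n \<in> X))"

lemma dense_seq: "open X \<Longrightarrow> X \<noteq> {} \<Longrightarrow> \<exists>n. (dense_seq n :: 'a::euclidean_space) \<in> X"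
proof -
  obtain D :: "'a set" where D: "countable D" "\<And>X. open X \<Longrightarrow> X \<noteq> {} \<Longrightarrow> \<exists>d\<in>D. d \<in> X"
    using countable_dense_exists by blast
  have "D \<noteq> {}" using D(2)[of UNIV] by auto
  then have "range (from_nat_into D) = D"
    using D(1) by (rule range_from_nat_into)
  then have "\<forall>X. open X \<longrightarrow> X \<noteq> {} \<longrightarrow> (\<exists>n. from_nat_into D n \<in> X)"
    using D(2) by (metis rangeE)
  then have "\<forall>X. open X \<longrightarrow> X \<noteq> {} \<longrightarrow> (\<exists>n. (dense_seq n :: 'a) \<in> X)"
    unfolding dense_seq_def
    by (rule someI[where P = "\<lambda>s. \<forall>X. open X \<longrightarrow> X \<noteq> {} \<longrightarrow> (\<exists>n. s n \<in> (X :: 'a set))"])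
  then show "open X \<Longrightarrow> X \<noteq> {} \<Longrightarrow> \<exists>n. (dense_seq n :: 'a) \<in> X" by blast
qed

text \<open>Connectedness in the complement of the nodal set is encoded by finite chains of balls from a
  countable family, each bounded away from zero on a countable dense set; this makes it a measurable
  condition on the values of the function.\<close>

definition basic_ball :: "nat \<times> nat \<Rightarrow> 'a::euclidean_space set" where
  "basic_ball b = ball (dense_seq (fst b)) (1 / Suc (snd b))"

lemma open_basic_ball [simp]: "open (basic_ball b)"
  and connected_basic_ball: "connected (basic_ball b)"
  by (auto simp: basic_ball_def)

lemma measurable_basic_ball [measurable]: "basic_ball b \<in> sets borel"
  by (rule borel_open[OF open_basic_ball])

lemma basic_ball_nbhd:
  assumes "open U" "x \<in> U"
  obtains b where "x \<in> basic_ball b" "basic_ball b \<subseteq> U"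
proof -
  obtain e where e: "e > 0" "ball x e \<subseteq> U" using assms by (meson openE)
  obtain k where k: "1 / Suc k < e / 2" using nat_approx_posE[of "e/2"] e by auto
  obtain i where i: "dense_seq i \<in> ball x (1 / Suc k)"
    using dense_seq[of "ball x (1 / Suc k)"] by auto
  show ?thesis
  proof (rule that[of "(i, k)"])
    show "x \<in> basic_ball (i, k)" using i by (simp add: basic_ball_def dist_commute)
    have "dist x y < e" if "y \<in> basic_ball (i, k)" for y
    proof -
      have "dist x y \<le> dist x (dense_seq i) + dist (dense_seq i) y" by (rule dist_triangle)
      also have "\<dots> < 1 / Suc k + 1 / Suc k" using i that by (simp add: basic_ball_def)
      finally show ?thesis using k by simp
    qed
    then show "basic_ball (i, k) \<subseteq> U" using e by auto
  qed
qed

text \<open>A uniform lower bound is required instead of mere nonvanishing: a continuous function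
  can be nonzero along the whole dense sequence and still vanish elsewhere in the ball. A bound on a
  dense set passes to the ball by continuity.\<close>

definition good_ball :: "('a::euclidean_space \<Rightarrow> real) \<Rightarrow> nat \<times> nat \<Rightarrow> bool" where
  "good_ball f b \<longleftrightarrow>
     (\<exists>m. \<forall>i. dense_seq i \<in> (basic_ball b :: 'a set) \<longrightarrow> 1 / Suc m \<le> \<bar>f (dense_seq i)\<bar>)"

lemma good_ball_nonzero:
  fixes f :: "'a::euclidean_space \<Rightarrow> real"
  assumes f: "continuous_on UNIV f" and "good_ball f b" "x \<in> basic_ball b"
  shows "f x \<noteq> 0"
proof
  assume "f x = 0"
  obtain m where m: "\<And>i. dense_seq i \<in> (basic_ball b :: 'a set) \<Longrightarrow> 1 / Suc m \<le> \<bar>f (dense_seq i)\<bar>"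
    using assms(2) unfolding good_ball_def by blast
  define U where "U = basic_ball b \<inter> {y. \<bar>f y\<bar> < 1 / Suc m}"
  have "open U" unfolding U_def
    by (intro open_Int open_basic_ball open_Collect_less continuous_intros f)
  moreover have "x \<in> U" using assms(3) \<open>f x = 0\<close> by (simp add: U_def)
  ultimately obtain i where "dense_seq i \<in> U" using dense_seq by blast
  then show False using m[of i] by (simp add: U_def)
qed

lemma good_ball_nbhd:
  fixes f :: "'a::euclidean_space \<Rightarrow> real"
  assumes f: "continuous_on UNIV f" and "f x \<noteq> 0"
  obtains b where "x \<in> basic_ball b" "good_ball f b"
proof -
  obtain m where m: "1 / Suc m < \<bar>f x\<bar>" using nat_approx_posE[of "\<bar>f x\<bar>"] assms by auto
  have "open {y. 1 / Suc m < \<bar>f y\<bar>}" by (intro open_Collect_less continuous_intros f)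
  then obtain b where "x \<in> basic_ball b" "basic_ball b \<subseteq> {y. 1 / Suc m < \<bar>f y\<bar>}"
    using basic_ball_nbhd[of "{y. 1 / Suc m < \<bar>f y\<bar>}" x] m by auto
  then show ?thesis 
    using that[of b] unfolding good_ball_def by (blast intro: less_imp_le)
qed

primrec ball_chain :: "('a::euclidean_space \<Rightarrow> real) \<Rightarrow> nat \<Rightarrow> nat \<times> nat \<Rightarrow> nat \<times> nat \<Rightarrow> bool" where
  "ball_chain f 0 b b' \<longleftrightarrow> b = b' \<and> good_ball f b"
| "ball_chain f (Suc n) b b' \<longleftrightarrow>
     (\<exists>c. ball_chain f n b c \<and> good_ball f b' \<and> basic_ball c \<inter> (basic_ball b' :: 'a set) \<noteq> {})"

definition chain_linked :: "('a::euclidean_space \<Rightarrow> real) \<Rightarrow> 'a \<Rightarrow> 'a \<Rightarrow> bool" where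
  "chain_linked f x y \<longleftrightarrow>
     (\<exists>b b' n. x \<in> basic_ball b \<and> y \<in> basic_ball b' \<and> ball_chain f n b b')"

lemma open_nodal_compl: "continuous_on UNIV f \<Longrightarrow> open (- nodal_set f)"
  unfolding nodal_set_def by (intro open_Compl closed_vimage) auto

lemma basic_ball_connected_component:
  assumes "continuous_on UNIV f" "good_ball f b" "x \<in> basic_ball b" "y \<in> basic_ball b"
  shows "connected_component (- nodal_set f) x y"
  unfolding connected_component_def
  using good_ball_nonzero[OF assms(1,2)] assms(3,4)
  by (intro exI[of _ "basic_ball b"]) (auto simp: nodal_set_def connected_basic_ball)

lemma ball_chain_connected:
  fixes f :: "'a::euclidean_space \<Rightarrow> real"
  assumes f: "continuous_on UNIV f"
  shows "ball_chain f n b b' \<Longrightarrow> x \<in> basic_ball b \<Longrightarrow> y \<in> basic_ball b' \<Longrightarrow>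
    connected_component (- nodal_set f) x y"
proof (induction n arbitrary: b' y)
  case 0
  then have "good_ball f b" "b = b'" by auto
  then show ?case using 0 basic_ball_connected_component[OF f] by blast
next
  case (Suc n)
  then obtain c and z :: 'a
    where c: "ball_chain f n b c" "good_ball f b'" "z \<in> basic_ball c" "z \<in> basic_ball b'"
    by (auto simp: disjoint_iff)
  from Suc.IH[OF c(1) Suc.prems(2) c(3)] basic_ball_connected_component[OF f c(2,4) Suc.prems(3)]
  show ?case by (rule connected_component_trans)
qed

text \<open>The points reached by chains and the points not reached both form open sets.\<close>

lemma chain_linked_iff:
  fixes f :: "'a::euclidean_space \<Rightarrow> real"
  assumes f: "continuous_on UNIV f"
  shows "chain_linked f x y \<longleftrightarrow> y \<in> cell f x"
proof
  assume "chain_linked f x y"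
  then show "y \<in> cell f x"
    unfolding chain_linked_def using ball_chain_connected[OF f] by auto
next
  assume "y \<in> cell f x"
  then obtain T where T: "connected T" "T \<subseteq> - nodal_set f" "x \<in> T" "y \<in> T"
    by (auto simp: connected_component_def)
  have nz: "f z \<noteq> 0" if "z \<in> T" for z using T(2) that by (auto simp: nodal_set_def)
  define A :: "'a set" where "A = \<Union>{basic_ball b' | b'. \<exists>b n. x \<in> basic_ball b \<and> ball_chain f n b b'}"
  define B :: "'a set" where "B = \<Union>{basic_ball c | c. good_ball f c \<and> A \<inter> basic_ball c = {}}"
  have A: "z \<in> A \<longleftrightarrow> chain_linked f x z" for z unfolding A_def chain_linked_def by blast
  have "open A" "open B" unfolding A_def B_def by (auto intro!: open_Union)
  moreover have "A \<inter> B = {}" by (auto simp: B_def)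
  moreover have "T \<subseteq> A \<union> B"
  proof
    fix z assume "z \<in> T"
    then obtain c where c: "z \<in> basic_ball c" "good_ball f c" using good_ball_nbhd[OF f nz] by blast
    \<comment> \<open>A good ball that meets \<open>A\<close> prolongs a chain by one link and
      therefore lies in \<open>A\<close>. So each point of \<open>T\<close> is either in
      \<open>A\<close> or has a good ball belonging to \<open>B\<close>.\<close>
    have "z \<in> A" if w: "w \<in> A" "w \<in> basic_ball c" for w
    proof -
      obtain b b' n where b: "x \<in> basic_ball b" "w \<in> basic_ball b'" "ball_chain f n b b'"
        using w by (auto simp: A_def)
      then have "basic_ball b' \<inter> basic_ball c \<noteq> ({} :: 'a set)" using w by blast
      then have "ball_chain f (Suc n) b c" using c b by (simp only: ball_chain.simps) blast
      then show ?thesis using b c unfolding A_def by blast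
    qed
    then show "z \<in> A \<union> B"
      using c unfolding B_def by (cases "A \<inter> basic_ball c = {}") blast+
  qed
  moreover have "x \<in> A \<inter> T"
  proof -
    obtain b where "x \<in> basic_ball b" "good_ball f b" using good_ball_nbhd[OF f nz] T by blast
    then have "ball_chain f 0 b b" by simp
    then show ?thesis using \<open>x \<in> basic_ball b\<close> T unfolding A_def by blast
  qed
  ultimately have "B \<inter> T = {}" using T(1) unfolding connected_def by blast
  then show "chain_linked f x y" using A T \<open>T \<subseteq> A \<union> B\<close> by blast
qed

lemma measurable_good_ball [measurable]:
  assumes [measurable]: "\<And>x. (\<lambda>\<omega>. g \<omega> x) \<in> borel_measurable N"
  shows "Measurable.pred N (\<lambda>\<omega>. good_ball (g \<omega>) b)"
  unfolding good_ball_def by measurable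

lemma measurable_ball_chain [measurable]:
  assumes [measurable]: "\<And>x. (\<lambda>\<omega>. g \<omega> x) \<in> borel_measurable N"
  shows "Measurable.pred N (\<lambda>\<omega>. ball_chain (g \<omega>) n b b')"
  by (induction n arbitrary: b') simp_all

lemma measurable_chain_linked [measurable]:
  assumes [measurable]: "\<And>x. (\<lambda>\<omega>. g \<omega> x) \<in> borel_measurable N" "h \<in> borel_measurable N"
  shows "Measurable.pred N (\<lambda>\<omega>. chain_linked (g \<omega>) x (h \<omega>))"
  unfolding chain_linked_def
  by (intro pred_intros_countable pred_intros_logic measurable_ball_chain) measurable

section \<open>Enumeration of the nodal domains and sums over them\<close>

lemma open_cell: "continuous_on UNIV f \<Longrightarrow> open (cell f x)"
  by (intro open_connected_component open_nodal_compl)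

lemma mem_cell_self [simp]: "x \<in> cell f x \<longleftrightarrow> f x \<noteq> 0"
  by (simp add: nodal_set_def)

lemma nodal_domains_eq: "nodal_domains f = cell f ` {x. f x \<noteq> 0}"
  by (auto simp: nodal_domains_def components_def nodal_set_def)

lemma cell_eq: "y \<in> cell f x \<Longrightarrow> cell f y = cell f x"
  using connected_component_eq[of y "- nodal_set f" x] by auto

text \<open>Picks one representative index for each domain, so that the random family of domains
  becomes a series over the natural numbers whose terms are measurable.\<close>

definition first_index :: "('a::euclidean_space \<Rightarrow> real) \<Rightarrow> nat \<Rightarrow> bool" where
  "first_index f i \<longleftrightarrow>
     f (dense_seq i) \<noteq> 0 \<and> (\<forall>j<i. dense_seq j \<notin> cell f (dense_seq i))"

text \<open>A domain is open and nonempty, hence contains a point of the dense sequence; the least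
  such index is its unique representative.\<close>

lemma bij_betw_first_index:
  fixes f :: "'a::euclidean_space \<Rightarrow> real"
  assumes f: "continuous_on UNIV f"
  shows "bij_betw (\<lambda>i. cell f (dense_seq i)) {i. first_index f i} (nodal_domains f)"
proof (rule bij_betwI')
  fix i j assume ij: "i \<in> {i. first_index f i}" "j \<in> {i. first_index f i}"
  show "(cell f (dense_seq i) = cell f (dense_seq j)) = (i = j)"
  proof
    assume eq: "cell f (dense_seq i) = cell f (dense_seq j)"
    have *: "dense_seq i \<in> cell f (dense_seq i)" "dense_seq j \<in> cell f (dense_seq j)"
      using ij unfolding mem_cell_self by (auto simp: first_index_def)
    have "\<not> i < j" "\<not> j < i" using ij * eq unfolding first_index_def by blast+
    then show "i = j" by simp
  qed simp
next
  fix i assume "i \<in> {i. first_index f i}"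
  then show "cell f (dense_seq i) \<in> nodal_domains f"
    by (auto simp: first_index_def nodal_domains_eq)
next
  fix D assume "D \<in> nodal_domains f"
  then obtain x where x: "f x \<noteq> 0" "D = cell f x" by (auto simp: nodal_domains_eq)
  have "open D" "D \<noteq> {}" using open_cell[OF f] mem_cell_self[of x f] x by blast+
  then obtain i0 where i0: "dense_seq i0 \<in> D" using dense_seq by blast
  define i where "i = (LEAST i. dense_seq i \<in> D)"
  have i: "dense_seq i \<in> D" unfolding i_def by (rule LeastI[of _ i0]) (fact i0)
  have D: "D = cell f (dense_seq i)" using i x(2) cell_eq by blast
  have "dense_seq j \<notin> D" if "j < i" for j using that not_less_Least unfolding i_def by blast
  then have "first_index f i" using i mem_cell_self[of "dense_seq i" f] unfolding first_index_def D by blast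
  then show "\<exists>i\<in>{i. first_index f i}. D = cell f (dense_seq i)" using D by blast
qed

text \<open>The index set on the left depends on \<open>f\<close>, the one on the right does not.
  Measurability and interchange of integrals are read off from the series.\<close>

lemma nn_integral_nodal_domains_eq_suminf:
  assumes "continuous_on UNIV f"
  shows "(\<integral>\<^sup>+D. \<phi> D \<partial>count_space (nodal_domains f)) =
    (\<Sum>i. of_bool (first_index f i) * \<phi> (cell f (dense_seq i)))"
proof -
  have "(\<integral>\<^sup>+D. \<phi> D \<partial>count_space (nodal_domains f)) =
      (\<integral>\<^sup>+i. \<phi> (cell f (dense_seq i)) \<partial>count_space {i. first_index f i})"
    using nn_integral_bij_count_space[OF bij_betw_first_index[OF assms], of \<phi>] by simp
  also have "\<dots> = (\<integral>\<^sup>+i. of_bool (first_index f i) * \<phi> (cell f (dense_seq i)) \<partial>count_space UNIV)"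
    by (subst nn_integral_count_space_indicator)
       (auto intro!: nn_integral_cong simp: indicator_def of_bool_def)
  finally show ?thesis by (simp add: nn_integral_count_space_nat)
qed

lemma emeasure_count_space_Collect:
  "emeasure (count_space UNIV) {x \<in> A. P x} = (\<integral>\<^sup>+x. of_bool (P x) \<partial>count_space A)"
proof -
  have "(\<integral>\<^sup>+x. of_bool (P x) \<partial>count_space A) = (\<integral>\<^sup>+x. indicator {x \<in> A. P x} x \<partial>count_space A)"
    by (intro nn_integral_cong) (auto simp: indicator_def)
  also have "\<dots> = emeasure (count_space A) {x \<in> A. P x}"
    by (rule nn_integral_indicator) simp
  also have "\<dots> = emeasure (count_space UNIV) {x \<in> A. P x}"
    by (simp add: emeasure_count_space)
  finally show ?thesis ..
qed

text \<open>The domains partition the complement of the nodal set, so at most one summand is nonzero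
  at \<open>x\<close>. This is what turns sums of volumes over domains into integrals over
  points.\<close>

lemma nn_integral_nodal_domains_at:
  "(\<integral>\<^sup>+D. \<phi> D * indicator D x \<partial>count_space (nodal_domains f)) = of_bool (f x \<noteq> 0) * \<phi> (cell f x)"
proof (cases "f x = 0")
  case True
  have "x \<notin> D" if "D \<in> nodal_domains f" for D
    using True that connected_component_subset[of "- nodal_set f"]
    unfolding nodal_domains_eq by (force simp: nodal_set_def)
  then have "(\<integral>\<^sup>+D. \<phi> D * indicator D x \<partial>count_space (nodal_domains f)) =
      (\<integral>\<^sup>+D. 0 \<partial>count_space (nodal_domains f))"
    by (intro nn_integral_cong) (auto simp: indicator_def)
  then show ?thesis using True by simp
next
  case False
  then have c: "cell f x \<in> nodal_domains f" by (auto simp: nodal_domains_eq)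
  have "x \<in> D \<longleftrightarrow> D = cell f x" if "D \<in> nodal_domains f" for D
    using that cell_eq[of x f] mem_cell_self[of x f] False unfolding nodal_domains_eq by blast
  then have "(\<integral>\<^sup>+D. \<phi> D * indicator D x \<partial>count_space (nodal_domains f)) =
      (\<integral>\<^sup>+D. \<phi> (cell f x) * indicator {cell f x} D \<partial>count_space (nodal_domains f))"
    by (intro nn_integral_cong) (auto simp: indicator_def)
  also have "\<dots> = \<phi> (cell f x) * emeasure (count_space (nodal_domains f)) {cell f x}"
    using c by (intro nn_integral_cmult_indicator) auto
  also have "\<dots> = \<phi> (cell f x)" using c by simp
  finally show ?thesis using False by simp
qed

text \<open>The dense sequence detects points outside the closed ball, because that difference is
  open. An open set inside the closed ball lies in its interior, which is the open ball.\<close>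

lemma open_subset_ball_iff:
  fixes D :: "'a::euclidean_space set"
  assumes "open D"
  shows "D \<subseteq> ball a r \<longleftrightarrow> (\<forall>j. dense_seq j \<in> D \<longrightarrow> dense_seq j \<in> ball a r)"
proof
  assume *: "\<forall>j. dense_seq j \<in> D \<longrightarrow> dense_seq j \<in> ball a r"
  have "D - cball a r = {}"
  proof (rule ccontr)
    assume "D - cball a r \<noteq> {}"
    moreover have "open (D - cball a r)" using assms by (intro open_Diff closed_cball)
    ultimately obtain j where "dense_seq j \<in> D - cball a r" using dense_seq by blast
    then show False using * by auto
  qed
  then have "D \<subseteq> interior (cball a r)" using assms by (intro interior_maximal) auto
  then show "D \<subseteq> ball a r" by simp
qed auto

lemma cell_subset_ball_iff:
  assumes "continuous_on UNIV f"
  shows "cell f x \<subseteq> ball a r \<longleftrightarrow> (\<forall>j. chain_linked f x (dense_seq j) \<longrightarrow> dense_seq j \<in> ball a r)"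
  unfolding open_subset_ball_iff[OF open_cell[OF assms]] chain_linked_iff[OF assms] ..

lemma cell_translate: "cell (\<lambda>y. f (y + h)) x = (\<lambda>y. y - h) ` cell f (x + h)"
proof -
  \<comment> \<open>General in \<open>g\<close> and \<open>k\<close>: with \<open>k = h\<close> it
    yields one inclusion, and with shift \<open>- h\<close> applied to the translated function the
    other.\<close>
  have *: "connected_component (- nodal_set (\<lambda>y. g (y + k))) a b"
    if c: "connected_component (- nodal_set g) (a + k) (b + k)" for g :: "'a \<Rightarrow> real" and k a b
  proof -
    obtain T where T: "connected T" "T \<subseteq> - nodal_set g" "a + k \<in> T" "b + k \<in> T"
      using c by (auto simp: connected_component_def)
    have "connected ((\<lambda>y. y - k) ` T)"
      by (intro connected_continuous_image continuous_intros T)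
    moreover have "(\<lambda>y. y - k) ` T \<subseteq> - nodal_set (\<lambda>y. g (y + k))"
      using T(2) by (auto simp: nodal_set_def)
    moreover have "a \<in> (\<lambda>y. y - k) ` T" "b \<in> (\<lambda>y. y - k) ` T" using T(3,4) by force+
    ultimately show ?thesis unfolding connected_component_def by blast
  qed
  show ?thesis
  proof (intro set_eqI iffI)
    fix y assume "y \<in> cell (\<lambda>y. f (y + h)) x"
    then have "y + h \<in> cell f (x + h)"
      using *[of "\<lambda>y. f (y + h)" "x + h" "- h" "y + h"] by simp
    then show "y \<in> (\<lambda>y. y - h) ` cell f (x + h)" by force
  next
    fix y assume "y \<in> (\<lambda>y. y - h) ` cell f (x + h)"
    then have "connected_component (- nodal_set f) (x + h) (y + h)" by auto
    then show "y \<in> cell (\<lambda>y. f (y + h)) x" using * by simp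
  qed
qed

section \<open>Measurability\<close>

text \<open>The parameter space is left arbitrary so that the results apply to the probability space
  and again to its product with Lebesgue measure. The second use supplies the joint measurability in
  sample point and position.\<close>

locale continuous_random_function =
  fixes N :: "'n measure" and g :: "'n \<Rightarrow> 'a::euclidean_space \<Rightarrow> real"
  assumes cont: "\<omega> \<in> space N \<Longrightarrow> continuous_on UNIV (g \<omega>)"
    and meas [measurable]: "\<And>x. (\<lambda>\<omega>. g \<omega> x) \<in> borel_measurable N"
begin

lemma pred_mem_cell:
  assumes [measurable]: "h \<in> borel_measurable N"
  shows "Measurable.pred N (\<lambda>\<omega>. h \<omega> \<in> cell (g \<omega>) x)"
proof -
  have "Measurable.pred N (\<lambda>\<omega>. chain_linked (g \<omega>) x (h \<omega>))"
    by (intro measurable_chain_linked) measurable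
  then show ?thesis
    by (rule measurable_cong[THEN iffD1, rotated]) (rule chain_linked_iff[OF cont])
qed

lemma pred_first_index [measurable]: "Measurable.pred N (\<lambda>\<omega>. first_index (g \<omega>) i)"
proof -
  have [measurable]: "Measurable.pred N (\<lambda>\<omega>. dense_seq j \<in> cell (g \<omega>) (dense_seq i))" for j
    by (rule pred_mem_cell) simp
  have "Measurable.pred N (\<lambda>\<omega>. g \<omega> (dense_seq i) \<noteq> 0)" by measurable
  moreover have "Measurable.pred N (\<lambda>\<omega>. \<forall>j<i. dense_seq j \<notin> cell (g \<omega>) (dense_seq i))"
    by measurable
  ultimately show ?thesis unfolding first_index_def by (rule pred_intros_logic)
qed

lemma pred_cell_subset_ball [measurable]: "Measurable.pred N (\<lambda>\<omega>. cell (g \<omega>) x \<subseteq> ball a r)"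
proof -
  have "Measurable.pred N
      (\<lambda>\<omega>. \<forall>j. chain_linked (g \<omega>) x (dense_seq j) \<longrightarrow> (dense_seq j :: 'a) \<in> ball a r)"
    by (intro pred_intros_countable pred_intros_logic measurable_chain_linked) measurable
  then show ?thesis
    by (rule measurable_cong[THEN iffD1, rotated]) (rule cell_subset_ball_iff[OF cont, symmetric])
qed

text \<open>The series representation evaluates \<open>\<phi>\<close> only at domains of
  deterministic points, so the hypothesis is asked for these alone.\<close>

lemma measurable_nn_integral_nodal_domains:
  assumes "\<And>x. (\<lambda>\<omega>. \<phi> \<omega> (cell (g \<omega>) x)) \<in> borel_measurable N"
  shows "(\<lambda>\<omega>. \<integral>\<^sup>+D. \<phi> \<omega> D \<partial>count_space (nodal_domains (g \<omega>))) \<in> borel_measurable N"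
proof -
  note [measurable] = assms
  have "(\<lambda>\<omega>. \<Sum>i. of_bool (first_index (g \<omega>) i) * \<phi> \<omega> (cell (g \<omega>) (dense_seq i)))
      \<in> borel_measurable N"
    by measurable
  then show ?thesis
    by (rule measurable_cong[THEN iffD1, rotated])
      (rule nn_integral_nodal_domains_eq_suminf[OF cont, symmetric])
qed

end

text \<open>On the product space, membership of the second coordinate in the domain of
  \<open>x\<close> is jointly measurable; integrating out that coordinate gives the volume.\<close>

lemma (in continuous_random_function) measurable_emeasure_cell [measurable]:
  "(\<lambda>\<omega>. emeasure lborel (cell (g \<omega>) x)) \<in> borel_measurable N"
proof -
  interpret P: continuous_random_function "N \<Otimes>\<^sub>M lborel" "\<lambda>z. g (fst z)"
    by unfold_locales (auto simp: space_pair_measure intro: cont)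
  have "Measurable.pred (N \<Otimes>\<^sub>M lborel) (\<lambda>z. snd z \<in> cell (g (fst z)) x)"
    by (rule P.pred_mem_cell) measurable
  then have "(\<lambda>\<omega>. \<integral>\<^sup>+y. of_bool (y \<in> cell (g \<omega>) x) \<partial>lborel) \<in> borel_measurable N"
    by (intro lborel.borel_measurable_nn_integral) (simp add: split_beta')
  moreover have "(\<integral>\<^sup>+y. of_bool (y \<in> cell (g \<omega>) x) \<partial>lborel) = emeasure lborel (cell (g \<omega>) x)"
    if "\<omega> \<in> space N" for \<omega>
  proof -
    have "(\<integral>\<^sup>+y. of_bool (y \<in> cell (g \<omega>) x) \<partial>lborel) =
        (\<integral>\<^sup>+y. indicator (cell (g \<omega>) x) y \<partial>lborel)"
      by (intro nn_integral_cong) (simp add: indicator_def)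
    also have "\<dots> = emeasure lborel (cell (g \<omega>) x)"
      using open_cell[OF cont[OF that]] by (intro nn_integral_indicator) simp
    finally show ?thesis .
  qed
  ultimately show ?thesis
    by (rule measurable_cong[THEN iffD1, rotated])
qed

section \<open>Stationarity and mean volumes\<close>

locale continuous_stationary_field = prob_space M + continuous_random_function M "\<lambda>\<omega> x. F x \<omega>"
  for M :: "'w measure" and F :: "'a::euclidean_space \<Rightarrow> 'w \<Rightarrow> real" +
  assumes stationary: "stationary_field M F"
begin

abbreviation path :: "'w \<Rightarrow> 'a \<Rightarrow> real" where
  "path \<omega> \<equiv> \<lambda>x. F x \<omega>"

abbreviation domains :: "'w \<Rightarrow> 'a set measure" where
  "domains \<omega> \<equiv> count_space (nodal_domains (path \<omega>))"

section \<open>Translation invariance of the law of the path\<close>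

lemma measurable_path_translate:
  "(\<lambda>\<omega> y. F (y + h) \<omega>) \<in> measurable M (\<Pi>\<^sub>M x\<in>UNIV. borel)"
  by (rule measurable_PiM_single') (auto simp: space_PiM)

text \<open>Stationarity equates the finite-dimensional laws, that is, the measures of cylinder
  sets; these determine a finite measure on the infinite product.\<close>

lemma distr_path_translate:
  "distr M (\<Pi>\<^sub>M x\<in>UNIV. borel) (\<lambda>\<omega> y. F (y + h) \<omega>) = distr M (\<Pi>\<^sub>M x\<in>UNIV. borel) (\<lambda>\<omega> y. F y \<omega>)"
    (is "?P = ?Q")
proof (rule measure_eqI_PiM_infinite[where I = UNIV and M = "\<lambda>_. borel"])
  show "finite_measure ?P"
    by (intro prob_space.finite_measure prob_space_distr measurable_path_translate)
next
  fix A :: "'a \<Rightarrow> real set" and J :: "'a set"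
  assume J: "finite J" "J \<subseteq> UNIV" and A: "\<And>i. i \<in> J \<Longrightarrow> A i \<in> sets borel"
  have *: "emeasure (distr M (\<Pi>\<^sub>M x\<in>UNIV. borel) (\<lambda>\<omega> y. F (y + k) \<omega>)) (prod_emb UNIV (\<lambda>_. borel) J (Pi\<^sub>E J A))
      = emeasure (distr M (\<Pi>\<^sub>M x\<in>J. borel) (\<lambda>\<omega>. \<lambda>x\<in>J. F (x + k) \<omega>)) (Pi\<^sub>E J A)" for k
  proof -
    have "(\<lambda>\<omega>. \<lambda>x\<in>J. F (x + k) \<omega>) \<in> measurable M (\<Pi>\<^sub>M x\<in>J. borel)"
      by (rule measurable_restrict) measurable
    moreover have "Pi\<^sub>E J A \<in> sets (\<Pi>\<^sub>M x\<in>J. borel)" using J A by (intro sets_PiM_I_finite) auto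
    moreover have "prod_emb UNIV (\<lambda>_. borel) J (Pi\<^sub>E J A) \<in> sets (\<Pi>\<^sub>M x\<in>UNIV. borel)"
      using J A by (intro sets_PiM_I) auto
    moreover have "(\<lambda>\<omega> y. F (y + k) \<omega>) -` prod_emb UNIV (\<lambda>_. borel) J (Pi\<^sub>E J A) \<inter> space M =
        (\<lambda>\<omega>. \<lambda>x\<in>J. F (x + k) \<omega>) -` Pi\<^sub>E J A \<inter> space M"
      by (auto simp: prod_emb_def space_PiM PiE_iff)
    ultimately show ?thesis by (simp add: emeasure_distr measurable_path_translate)
  qed
  have "distr M (\<Pi>\<^sub>M x\<in>J. borel) (\<lambda>\<omega>. \<lambda>x\<in>J. F (x + h) \<omega>) = distr M (\<Pi>\<^sub>M x\<in>J. borel) (\<lambda>\<omega>. \<lambda>x\<in>J. F x \<omega>)"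
    using stationary J unfolding stationary_field_def by blast
  then show "emeasure ?P (prod_emb UNIV (\<lambda>_. borel) J (Pi\<^sub>E J A)) =
      emeasure ?Q (prod_emb UNIV (\<lambda>_. borel) J (Pi\<^sub>E J A))"
    using *[of h] *[of 0] by simp
qed simp_all

lemma prob_path_translate:
  assumes [measurable]: "Measurable.pred (\<Pi>\<^sub>M x\<in>UNIV. borel) P"
  shows "prob {\<omega> \<in> space M. P (\<lambda>y. F (y + h) \<omega>)} = prob {\<omega> \<in> space M. P (path \<omega>)}"
proof -
  have S: "{f \<in> space (\<Pi>\<^sub>M x\<in>UNIV. borel). P f} \<in> sets (\<Pi>\<^sub>M x\<in>UNIV. borel)" by measurable
  have "measure (distr M (\<Pi>\<^sub>M x\<in>UNIV. borel) (\<lambda>\<omega> y. F (y + k) \<omega>)) {f \<in> space (\<Pi>\<^sub>M x\<in>UNIV. borel). P f}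
      = prob {\<omega> \<in> space M. P (\<lambda>y. F (y + k) \<omega>)}" for k
    by (subst measure_distr[OF measurable_path_translate S]) (auto simp: space_PiM intro!: arg_cong[where f = prob])
  from this[of h] this[of 0] show ?thesis by (simp add: distr_path_translate)
qed

text \<open>The condition \<open>F 0 \<omega> \<noteq> 0\<close> matters: on the nodal set the cell
  is empty and would be contained in every ball.\<close>

definition local_prob :: "real \<Rightarrow> real" where
  "local_prob r = prob {\<omega> \<in> space M. F 0 \<omega> \<noteq> 0 \<and> cell (path \<omega>) 0 \<subseteq> ball 0 r}"

definition bounded_prob :: real where
  "bounded_prob = prob {\<omega> \<in> space M. F 0 \<omega> \<noteq> 0 \<and> bounded (cell (path \<omega>) 0)}"

text \<open>Translation invariance is available for events of the product \<sigma>-algebra.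
  Containment in the ball is therefore expressed by \<open>P\<close> through chains of balls, which
  involves countably many values and agrees with containment on continuous paths.\<close>

lemma prob_cell_subset_ball:
  "prob {\<omega> \<in> space M. F x \<omega> \<noteq> 0 \<and> cell (path \<omega>) x \<subseteq> ball x r} = local_prob r"
proof -
  define P :: "('a \<Rightarrow> real) \<Rightarrow> bool" where
    "P f \<longleftrightarrow> f 0 \<noteq> 0 \<and> (\<forall>j. chain_linked f 0 (dense_seq j) \<longrightarrow> dense_seq j \<in> (ball 0 r :: 'a set))" for f
  have [measurable]: "(\<lambda>f. f y) \<in> borel_measurable (\<Pi>\<^sub>M x\<in>UNIV. borel)" for y :: 'a by simp
  have [measurable]: "Measurable.pred (\<Pi>\<^sub>M x\<in>UNIV. borel) (\<lambda>f. chain_linked f 0 (dense_seq j :: 'a))" for j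
    by (rule measurable_chain_linked) auto
  have P: "Measurable.pred (\<Pi>\<^sub>M x\<in>UNIV. borel) P" unfolding P_def by measurable
  have P_iff: "P f \<longleftrightarrow> f 0 \<noteq> 0 \<and> cell f 0 \<subseteq> ball 0 r" if "continuous_on UNIV f" for f
    using that by (simp add: P_def cell_subset_ball_iff)
  have "P (\<lambda>y. F (y + x) \<omega>) \<longleftrightarrow> F x \<omega> \<noteq> 0 \<and> cell (path \<omega>) x \<subseteq> ball x r" if "\<omega> \<in> space M" for \<omega>
  proof -
    have "continuous_on UNIV (\<lambda>y. F (y + x) \<omega>)"
      by (rule continuous_on_compose2[OF cont[OF that]]) (auto intro!: continuous_intros)
    then show ?thesis
      by (auto simp: P_iff cell_translate[of "path \<omega>"] image_subset_iff subset_iff dist_norm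
        norm_minus_commute)
  qed
  then have "prob {\<omega> \<in> space M. F x \<omega> \<noteq> 0 \<and> cell (path \<omega>) x \<subseteq> ball x r} =
      prob {\<omega> \<in> space M. P (\<lambda>y. F (y + x) \<omega>)}"
    by (intro arg_cong[where f = prob]) auto
  also have "\<dots> = prob {\<omega> \<in> space M. P (path \<omega>)}" by (rule prob_path_translate[OF P])
  also have "\<dots> = local_prob r"
    unfolding local_prob_def using P_iff[OF cont] by (intro arg_cong[where f = prob]) auto
  finally show ?thesis .
qed

section \<open>The probability that a domain is bounded\<close>

lemma bounded_cell_iff: "bounded (C :: 'a set) \<longleftrightarrow> (\<exists>n::nat. C \<subseteq> ball x (real n))"
proof
  assume "bounded C"
  then obtain e where "C \<subseteq> ball x e" by (metis bounded_subset_ballD)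
  then show "\<exists>n::nat. C \<subseteq> ball x (real n)"
    using reals_Archimedean2[of e] by (meson subset_ball subset_trans less_imp_le)
qed (auto intro: bounded_subset)

text \<open>Continuity from below along integer radii. The sequence does not involve
  \<open>x\<close>, so uniqueness of limits makes the limiting probability the same at every
  point.\<close>

lemma local_prob_tendsto_at:
  "(\<lambda>n. local_prob (real n)) \<longlonglongrightarrow> prob {\<omega> \<in> space M. F x \<omega> \<noteq> 0 \<and> bounded (cell (path \<omega>) x)}"
proof -
  define A where "A n = {\<omega> \<in> space M. F x \<omega> \<noteq> 0 \<and> cell (path \<omega>) x \<subseteq> ball x (real n)}" for n :: nat
  have [measurable]: "A n \<in> sets M" for n unfolding A_def by measurable
  have "incseq A" by (intro incseq_SucI) (auto simp: A_def)
  then have "(\<lambda>n. prob (A n)) \<longlonglongrightarrow> prob (\<Union>n. A n)"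
    by (intro finite_Lim_measure_incseq) auto
  moreover have "(\<Union>n. A n) = {\<omega> \<in> space M. F x \<omega> \<noteq> 0 \<and> bounded (cell (path \<omega>) x)}"
    unfolding A_def bounded_cell_iff[of _ x] by auto
  ultimately show ?thesis by (simp add: A_def prob_cell_subset_ball)
qed

lemma local_prob_tendsto: "(\<lambda>n. local_prob (real n)) \<longlonglongrightarrow> bounded_prob"
  unfolding bounded_prob_def by (rule local_prob_tendsto_at)

lemma prob_bounded_cell: "prob {\<omega> \<in> space M. F x \<omega> \<noteq> 0 \<and> bounded (cell (path \<omega>) x)} = bounded_prob"
  using LIMSEQ_unique[OF local_prob_tendsto_at local_prob_tendsto] .

lemma pred_bounded_cell [measurable]: "Measurable.pred M (\<lambda>\<omega>. bounded (cell (path \<omega>) x))"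
  unfolding bounded_cell_iff[of _ 0] by measurable

text \<open>The unbounded event and the complement of the bounded one differ only where the origin
  lies on the nodal set, which the hypothesis makes negligible.\<close>

lemma percolation_probability_eq:
  assumes "AE \<omega> in M. F 0 \<omega> \<noteq> 0"
  shows "1 - percolation_probability M F = bounded_prob"
proof -
  have "(\<exists>D\<in>nodal_domains (path \<omega>). 0 \<in> D \<and> \<not> bounded D) \<longleftrightarrow>
      F 0 \<omega> \<noteq> 0 \<and> \<not> bounded (cell (path \<omega>) 0)" for \<omega>
  proof
    assume "\<exists>D\<in>nodal_domains (path \<omega>). 0 \<in> D \<and> \<not> bounded D"
    then obtain x where x: "0 \<in> cell (path \<omega>) x" "\<not> bounded (cell (path \<omega>) x)"
      unfolding nodal_domains_eq by blast
    show "F 0 \<omega> \<noteq> 0 \<and> \<not> bounded (cell (path \<omega>) 0)"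
      using cell_eq[OF x(1)] x mem_cell_self[of 0 "path \<omega>"] by metis
  next
    assume "F 0 \<omega> \<noteq> 0 \<and> \<not> bounded (cell (path \<omega>) 0)"
    then show "\<exists>D\<in>nodal_domains (path \<omega>). 0 \<in> D \<and> \<not> bounded D"
      using mem_cell_self[of 0 "path \<omega>"] unfolding nodal_domains_eq by blast
  qed
  then have "percolation_probability M F = prob {\<omega> \<in> space M. F 0 \<omega> \<noteq> 0 \<and> \<not> bounded (cell (path \<omega>) 0)}"
    by (simp add: percolation_probability_def)
  also have "\<dots> = prob (space M - {\<omega> \<in> space M. F 0 \<omega> \<noteq> 0 \<and> bounded (cell (path \<omega>) 0)})"
    using assms by (intro finite_measure_eq_AE) auto
  also have "\<dots> = 1 - bounded_prob"
    unfolding bounded_prob_def by (rule prob_compl) measurable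
  finally show ?thesis by simp
qed

text \<open>Indexing the domains by \<open>first_index\<close> gives a series of jointly measurable
  functions, to which Tonelli applies. The variable \<open>y\<close> has a type of its own because
  it serves both as a point of space and as a volume threshold.\<close>

lemma nn_integral_nodal_domains_Fubini:
  fixes \<psi> :: "'w \<Rightarrow> 'a set \<Rightarrow> 'b::euclidean_space \<Rightarrow> ennreal"
  assumes "\<And>x. (\<lambda>z. \<psi> (fst z) (cell (path (fst z)) x) (snd z)) \<in> borel_measurable (M \<Otimes>\<^sub>M lborel)"
  shows "(\<integral>\<^sup>+\<omega>. \<integral>\<^sup>+D. \<integral>\<^sup>+y. \<psi> \<omega> D y \<partial>lborel \<partial>domains \<omega> \<partial>M) =
    (\<integral>\<^sup>+y. \<integral>\<^sup>+\<omega>. \<integral>\<^sup>+D. \<psi> \<omega> D y \<partial>domains \<omega> \<partial>M \<partial>lborel)"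
proof -
  interpret P: pair_sigma_finite M "lborel :: 'b measure" ..
  define u where "u i \<omega> y = of_bool (first_index (path \<omega>) i) * \<psi> \<omega> (cell (path \<omega>) (dense_seq i)) y"
    for i \<omega> y
  note [measurable] = assms
  have u [measurable]: "(\<lambda>z. u i (fst z) (snd z)) \<in> borel_measurable (M \<Otimes>\<^sub>M lborel)" for i
    unfolding u_def by measurable
  have "(\<lambda>y. \<psi> \<omega> (cell (path \<omega>) x) y) \<in> borel_measurable lborel" if "\<omega> \<in> space M" for x \<omega>
    using measurable_Pair2[OF assms that] by simp
  then have "(\<integral>\<^sup>+D. \<integral>\<^sup>+y. \<psi> \<omega> D y \<partial>lborel \<partial>domains \<omega>) = (\<integral>\<^sup>+y. (\<Sum>i. u i \<omega> y) \<partial>lborel)"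
    if "\<omega> \<in> space M" for \<omega>
    using that unfolding u_def
    by (subst nn_integral_suminf)
      (auto simp: nn_integral_nodal_domains_eq_suminf[OF cont[OF that]] nn_integral_cmult)
  then have "(\<integral>\<^sup>+\<omega>. \<integral>\<^sup>+D. \<integral>\<^sup>+y. \<psi> \<omega> D y \<partial>lborel \<partial>domains \<omega> \<partial>M) =
      (\<integral>\<^sup>+\<omega>. \<integral>\<^sup>+y. (\<Sum>i. u i \<omega> y) \<partial>lborel \<partial>M)"
    by (intro nn_integral_cong) auto
  also have "\<dots> = (\<integral>\<^sup>+y. \<integral>\<^sup>+\<omega>. (\<Sum>i. u i \<omega> y) \<partial>M \<partial>lborel)"
    by (rule P.Fubini'[symmetric]) (simp add: split_beta')
  also have "\<dots> = (\<integral>\<^sup>+y. \<integral>\<^sup>+\<omega>. \<integral>\<^sup>+D. \<psi> \<omega> D y \<partial>domains \<omega> \<partial>M \<partial>lborel)"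
    by (intro nn_integral_cong)
      (auto simp: u_def nn_integral_nodal_domains_eq_suminf[OF cont])
  finally show ?thesis .
qed

text \<open>Write each volume as the integral of an indicator and exchange; at a given point only
  the domain containing it then contributes.\<close>

lemma nn_integral_nodal_domains_volume:
  assumes "\<And>x. (\<lambda>\<omega>. \<phi> (cell (path \<omega>) x)) \<in> borel_measurable M"
  shows "(\<integral>\<^sup>+\<omega>. \<integral>\<^sup>+D. \<phi> D * emeasure lborel D \<partial>domains \<omega> \<partial>M) =
    (\<integral>\<^sup>+x. \<integral>\<^sup>+\<omega>. of_bool (F x \<omega> \<noteq> 0) * \<phi> (cell (path \<omega>) x) \<partial>M \<partial>lborel)"
proof -
  interpret P: continuous_random_function "M \<Otimes>\<^sub>M lborel" "\<lambda>z. path (fst z)"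
    by unfold_locales (auto simp: space_pair_measure intro: cont)
  note [measurable] = assms
  have [measurable]: "Measurable.pred (M \<Otimes>\<^sub>M lborel) (\<lambda>z. snd z \<in> cell (path (fst z)) x)" for x
    by (rule P.pred_mem_cell) measurable
  have "(\<integral>\<^sup>+\<omega>. \<integral>\<^sup>+D. \<phi> D * emeasure lborel D \<partial>domains \<omega> \<partial>M) =
    (\<integral>\<^sup>+\<omega>. \<integral>\<^sup>+D. \<integral>\<^sup>+y. \<phi> D * indicator D y \<partial>lborel \<partial>domains \<omega> \<partial>M)"
  proof (intro nn_integral_cong)
    fix \<omega> D assume "\<omega> \<in> space M" "D \<in> space (domains \<omega>)"
    then have "open D" using open_cell[OF cont] by (auto simp: nodal_domains_eq)
    then show "\<phi> D * emeasure lborel D = (\<integral>\<^sup>+y. \<phi> D * indicator D y \<partial>lborel)"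
      by (subst nn_integral_cmult) auto
  qed
  also have "\<dots> = (\<integral>\<^sup>+y. \<integral>\<^sup>+\<omega>. \<integral>\<^sup>+D. \<phi> D * indicator D y \<partial>domains \<omega> \<partial>M \<partial>lborel)"
    by (rule nn_integral_nodal_domains_Fubini) (unfold indicator_def, measurable)
  finally show ?thesis by (simp add: nn_integral_nodal_domains_at)
qed

end

section \<open>Counts of domains split by volume\<close>

lemma nodal_count_eq:
  "nodal_count f R = (\<integral>\<^sup>+D. of_bool (D \<subseteq> ball 0 R) \<partial>count_space (nodal_domains f))"
  unfolding nodal_count_def by (rule emeasure_count_space_Collect)

lemma nodal_count_vol_eq:
  "nodal_count_vol f t R =
    (\<integral>\<^sup>+D. of_bool (D \<subseteq> ball 0 R \<and> measure lborel D < t) \<partial>count_space (nodal_domains f))"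
  unfolding nodal_count_vol_def by (rule emeasure_count_space_Collect)

text \<open>Counted directly, since the difference of \<open>nodal_count\<close> and
  \<open>nodal_count_vol\<close> would not recover this number where both are infinite.\<close>

definition nodal_count_large :: "('a::euclidean_space \<Rightarrow> real) \<Rightarrow> real \<Rightarrow> real \<Rightarrow> ennreal" where
  "nodal_count_large f t R =
    (\<integral>\<^sup>+D. of_bool (D \<subseteq> ball 0 R \<and> t \<le> measure lborel D) \<partial>count_space (nodal_domains f))"

lemma nodal_count_split: "nodal_count f R = nodal_count_vol f t R + nodal_count_large f t R"
  unfolding nodal_count_eq nodal_count_vol_eq nodal_count_large_def
  by (subst nn_integral_add[symmetric]) (auto intro!: nn_integral_cong)

text \<open>Finiteness inside a ball keeps \<open>measure\<close> away from the default value 0 that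
  it takes on sets of infinite volume.\<close>

lemma emeasure_lborel_subset_ball:
  fixes D :: "'a::euclidean_space set"
  assumes "D \<subseteq> ball a r"
  shows "emeasure lborel D = ennreal (measure lborel D)"
proof -
  have "emeasure lborel D \<le> emeasure lborel (ball a r)" using assms by (intro emeasure_mono) auto
  also have "\<dots> < \<infinity>" by (intro emeasure_bounded_finite) simp
  finally show ?thesis by (intro emeasure_eq_ennreal_measure) auto
qed

lemma nn_integral_layer_cake_truncated:
  fixes m T :: real
  assumes "0 \<le> m" "0 \<le> T"
  shows "(\<integral>\<^sup>+t. indicator {0<..<T} t * of_bool (t \<le> m) \<partial>lborel) = ennreal (min m T)"
proof -
  have "(\<integral>\<^sup>+t. indicator {0<..<T} t * of_bool (t \<le> m) \<partial>lborel) =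
      (\<integral>\<^sup>+t. indicator ({0<..<T} \<inter> {..m}) t \<partial>lborel)"
    by (intro nn_integral_cong) (auto simp: indicator_def)
  also have "\<dots> = emeasure lborel ({0<..<T} \<inter> {..m})" by simp
  also have "{0<..<T} \<inter> {..m} = (if m < T then {0<..m} else {0<..<T})" by auto
  also have "emeasure lborel \<dots> = ennreal (min m T)" using assms by auto
  finally show ?thesis .
qed

section \<open>Two-sided bounds for the mean truncated volume\<close>

context continuous_stationary_field
begin

lemma measurable_measure_cell [measurable]:
  "(\<lambda>\<omega>. measure lborel (cell (path \<omega>) x)) \<in> borel_measurable M"
  unfolding measure_def by measurable

lemma measurable_nodal_counts [measurable]:
  "(\<lambda>\<omega>. nodal_count (path \<omega>) R) \<in> borel_measurable M"
  "(\<lambda>\<omega>. nodal_count_vol (path \<omega>) t R) \<in> borel_measurable M"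
  "(\<lambda>\<omega>. nodal_count_large (path \<omega>) t R) \<in> borel_measurable M"
  unfolding nodal_count_eq nodal_count_vol_eq nodal_count_large_def
  by (intro measurable_nn_integral_nodal_domains; measurable)+

lemma measurable_mean_nodal_count_large [measurable]:
  "(\<lambda>t. \<integral>\<^sup>+\<omega>. nodal_count_large (path \<omega>) t R \<partial>M) \<in> borel_measurable lborel"
proof -
  have "(\<lambda>z. \<Sum>i. of_bool (first_index (path (snd z)) i) *
      of_bool (cell (path (snd z)) (dense_seq i) \<subseteq> ball 0 R \<and>
        fst z \<le> measure lborel (cell (path (snd z)) (dense_seq i))) :: ennreal)
      \<in> borel_measurable (lborel \<Otimes>\<^sub>M M)" (is "?h \<in> _")
    by measurable
  then have "(\<lambda>t. \<integral>\<^sup>+\<omega>. ?h (t, \<omega>) \<partial>M) \<in> borel_measurable lborel"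
    by (intro borel_measurable_nn_integral) simp
  moreover have "(\<integral>\<^sup>+\<omega>. ?h (t, \<omega>) \<partial>M) = (\<integral>\<^sup>+\<omega>. nodal_count_large (path \<omega>) t R \<partial>M)" for t
    unfolding nodal_count_large_def
    by (intro nn_integral_cong) (simp add: nn_integral_nodal_domains_eq_suminf[OF cont])
  ultimately show ?thesis by (simp only:)
qed

text \<open>The layer-cake formula for each domain, followed by an exchange of the threshold
  integral with sum and expectation. Truncation at \<open>T\<close> confines the thresholds to a
  bounded interval, as dominated convergence will require.\<close>

lemma nn_integral_mean_nodal_count_large:
  assumes "0 \<le> T"
  shows "(\<integral>\<^sup>+t. indicator {0<..<T} t * (\<integral>\<^sup>+\<omega>. nodal_count_large (path \<omega>) t R \<partial>M) \<partial>lborel) =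
    (\<integral>\<^sup>+\<omega>. \<integral>\<^sup>+D. of_bool (D \<subseteq> ball 0 R) * ennreal (min (measure lborel D) T) \<partial>domains \<omega> \<partial>M)"
proof -
  have "(\<integral>\<^sup>+\<omega>. \<integral>\<^sup>+D. of_bool (D \<subseteq> ball 0 R) * ennreal (min (measure lborel D) T) \<partial>domains \<omega> \<partial>M) =
    (\<integral>\<^sup>+\<omega>. \<integral>\<^sup>+D. \<integral>\<^sup>+t. of_bool (D \<subseteq> ball 0 R) * (indicator {0<..<T} t * of_bool (t \<le> measure lborel D))
      \<partial>lborel \<partial>domains \<omega> \<partial>M)"
    by (intro nn_integral_cong, subst nn_integral_cmult)
      (auto simp: nn_integral_layer_cake_truncated assms)
  also have "\<dots> = (\<integral>\<^sup>+t. \<integral>\<^sup>+\<omega>. \<integral>\<^sup>+D. of_bool (D \<subseteq> ball 0 R) *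
      (indicator {0<..<T} t * of_bool (t \<le> measure lborel D)) \<partial>domains \<omega> \<partial>M \<partial>lborel)"
    by (rule nn_integral_nodal_domains_Fubini) measurable
  also have "\<dots> = (\<integral>\<^sup>+t. indicator {0<..<T} t * (\<integral>\<^sup>+\<omega>. nodal_count_large (path \<omega>) t R \<partial>M) \<partial>lborel)"
    unfolding nodal_count_large_def
    by (intro nn_integral_cong) (auto simp: indicator_def intro!: nn_integral_cong)
  finally show ?thesis ..
qed

lemma mean_volume_upper:
  assumes "0 \<le> T"
  shows "(\<integral>\<^sup>+t. indicator {0<..<T} t * (\<integral>\<^sup>+\<omega>. nodal_count_large (path \<omega>) t R \<partial>M) \<partial>lborel)
    \<le> ennreal bounded_prob * emeasure lborel (ball (0::'a) R)"
proof -
  have "(\<integral>\<^sup>+\<omega>. \<integral>\<^sup>+D. of_bool (D \<subseteq> ball 0 R) * ennreal (min (measure lborel D) T) \<partial>domains \<omega> \<partial>M)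
      \<le> (\<integral>\<^sup>+\<omega>. \<integral>\<^sup>+D. of_bool (D \<subseteq> ball 0 R) * emeasure lborel D \<partial>domains \<omega> \<partial>M)"
    by (intro nn_integral_mono) (auto simp: emeasure_lborel_subset_ball intro!: ennreal_leI)
  also have "\<dots> = (\<integral>\<^sup>+x. \<integral>\<^sup>+\<omega>. of_bool (F x \<omega> \<noteq> 0) * of_bool (cell (path \<omega>) x \<subseteq> ball 0 R) \<partial>M \<partial>lborel)"
    by (rule nn_integral_nodal_domains_volume) measurable
  \<comment> \<open>A point whose domain lies in \<open>ball 0 R\<close> is itself in that ball and
    has a bounded domain; by stationarity the latter has probability \<open>bounded_prob\<close> at
    every point.\<close>
  also have "\<dots> \<le> (\<integral>\<^sup>+x. ennreal bounded_prob * indicator (ball (0::'a) R) x \<partial>lborel)"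
  proof (intro nn_integral_mono)
    fix x :: 'a
    define B where "B = {\<omega> \<in> space M. F x \<omega> \<noteq> 0 \<and> bounded (cell (path \<omega>) x)}"
    have [measurable]: "B \<in> sets M" unfolding B_def by measurable
    have "(\<integral>\<^sup>+\<omega>. of_bool (F x \<omega> \<noteq> 0) * of_bool (cell (path \<omega>) x \<subseteq> ball 0 R) \<partial>M)
        \<le> (\<integral>\<^sup>+\<omega>. indicator (ball 0 R) x * indicator B \<omega> \<partial>M)"
    proof (intro nn_integral_mono)
      fix \<omega> assume \<omega>: "\<omega> \<in> space M"
      show "of_bool (F x \<omega> \<noteq> 0) * of_bool (cell (path \<omega>) x \<subseteq> ball 0 R)
          \<le> (indicator (ball 0 R) x * indicator B \<omega> :: ennreal)"
      proof (cases "F x \<omega> \<noteq> 0 \<and> cell (path \<omega>) x \<subseteq> ball 0 R")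
        case True
        then have "x \<in> ball 0 R" using mem_cell_self[of x "path \<omega>"] by blast
        moreover have "\<omega> \<in> B" using True \<omega> by (auto simp: B_def intro: bounded_subset[OF bounded_ball])
        ultimately show ?thesis by simp
      qed auto
    qed
    also have "\<dots> = ennreal bounded_prob * indicator (ball 0 R) x"
      by (subst nn_integral_cmult)
        (auto simp: emeasure_eq_measure B_def[symmetric] mult.commute prob_bounded_cell[of x, folded B_def])
    finally show "(\<integral>\<^sup>+\<omega>. of_bool (F x \<omega> \<noteq> 0) * of_bool (cell (path \<omega>) x \<subseteq> ball 0 R) \<partial>M)
      \<le> ennreal bounded_prob * indicator (ball 0 R) x" .
  qed
  also have "\<dots> = ennreal bounded_prob * emeasure lborel (ball (0::'a) R)"
    by (rule nn_integral_cmult_indicator) simp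
  finally show ?thesis unfolding nn_integral_mean_nodal_count_large[OF assms] .
qed

text \<open>If \<open>x\<close> lies in \<open>ball 0 (R - L)\<close> and its domain in
  \<open>ball x L\<close>, then the domain lies in \<open>ball 0 R\<close> and has volume at most
  \<open>T\<close>, so truncation does not change it. The auxiliary \<open>\<phi>\<close> keeps
  exactly the domains with these two properties.\<close>

lemma mean_volume_lower:
  fixes L R :: real
  defines "T \<equiv> measure lborel (ball (0::'a) L)"
  shows "ennreal (local_prob L) * emeasure lborel (ball (0::'a) (R - L))
    \<le> (\<integral>\<^sup>+t. indicator {0<..<T} t * (\<integral>\<^sup>+\<omega>. nodal_count_large (path \<omega>) t R \<partial>M) \<partial>lborel)"
proof -
  define \<phi> where "\<phi> D = (of_bool (D \<subseteq> ball 0 R \<and> measure lborel D \<le> T) :: ennreal)" for D :: "'a set"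
  have [measurable]: "(\<lambda>\<omega>. \<phi> (cell (path \<omega>) x)) \<in> borel_measurable M" for x
    unfolding \<phi>_def by measurable
  have "ennreal (local_prob L) * emeasure lborel (ball (0::'a) (R - L)) =
      (\<integral>\<^sup>+x. ennreal (local_prob L) * indicator (ball (0::'a) (R - L)) x \<partial>lborel)"
    by (rule nn_integral_cmult_indicator[symmetric]) simp
  also have "\<dots> \<le> (\<integral>\<^sup>+x. \<integral>\<^sup>+\<omega>. of_bool (F x \<omega> \<noteq> 0) * \<phi> (cell (path \<omega>) x) \<partial>M \<partial>lborel)"
  proof (intro nn_integral_mono)
    fix x :: 'a
    define B where "B = {\<omega> \<in> space M. F x \<omega> \<noteq> 0 \<and> cell (path \<omega>) x \<subseteq> ball x L}"
    have [measurable]: "B \<in> sets M" unfolding B_def by measurable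
    have "ennreal (local_prob L) * indicator (ball 0 (R - L)) x =
        (\<integral>\<^sup>+\<omega>. indicator (ball 0 (R - L)) x * indicator B \<omega> \<partial>M)"
      by (subst nn_integral_cmult)
        (auto simp: emeasure_eq_measure mult.commute prob_cell_subset_ball[of x L, folded B_def])
    also have "\<dots> \<le> (\<integral>\<^sup>+\<omega>. of_bool (F x \<omega> \<noteq> 0) * \<phi> (cell (path \<omega>) x) \<partial>M)"
    proof (intro nn_integral_mono)
      fix \<omega> assume \<omega>: "\<omega> \<in> space M"
      show "(indicator (ball 0 (R - L)) x * indicator B \<omega> :: ennreal)
          \<le> of_bool (F x \<omega> \<noteq> 0) * \<phi> (cell (path \<omega>) x)"
      proof (cases "x \<in> ball 0 (R - L) \<and> \<omega> \<in> B")
        case True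
        then have sub: "cell (path \<omega>) x \<subseteq> ball x L" and nz: "F x \<omega> \<noteq> 0" by (auto simp: B_def)
        have "ball x L \<subseteq> ball 0 R"
        proof
          fix y assume "y \<in> ball x L"
          then have "dist 0 x + dist x y < R" using True by auto
          then show "y \<in> ball 0 R" using dist_triangle[of 0 y x] by (simp del: dist_0_norm)
        qed
        moreover have "measure lborel (cell (path \<omega>) x) \<le> T"
        proof -
          have "measure lborel (cell (path \<omega>) x) \<le> measure lborel (ball x L)"
            using sub open_cell[OF cont[OF \<omega>]]
            by (intro measure_mono_fmeasurable fmeasurableI)
              (auto simp: emeasure_bounded_finite[OF bounded_ball, simplified])
          \<comment> \<open>Volume is translation invariant; for negative \<open>L\<close> both
            balls are empty.\<close>
          also have "\<dots> = T"
            unfolding T_def by (cases "0 \<le> L") (auto simp: content_ball ball_empty)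
          finally show ?thesis .
        qed
        ultimately have "\<phi> (cell (path \<omega>) x) = 1" using sub by (auto simp: \<phi>_def)
        then show ?thesis using True nz by simp
      qed auto
    qed
    finally show "ennreal (local_prob L) * indicator (ball 0 (R - L)) x
      \<le> (\<integral>\<^sup>+\<omega>. of_bool (F x \<omega> \<noteq> 0) * \<phi> (cell (path \<omega>) x) \<partial>M)" .
  qed
  also have "\<dots> = (\<integral>\<^sup>+\<omega>. \<integral>\<^sup>+D. \<phi> D * emeasure lborel D \<partial>domains \<omega> \<partial>M)"
    by (rule nn_integral_nodal_domains_volume[symmetric]) measurable
  also have "\<dots> \<le> (\<integral>\<^sup>+\<omega>. \<integral>\<^sup>+D. of_bool (D \<subseteq> ball 0 R) * ennreal (min (measure lborel D) T) \<partial>domains \<omega> \<partial>M)"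
    by (intro nn_integral_mono) (auto simp: \<phi>_def emeasure_lborel_subset_ball)
  also have "\<dots> = (\<integral>\<^sup>+t. indicator {0<..<T} t * (\<integral>\<^sup>+\<omega>. nodal_count_large (path \<omega>) t R \<partial>M) \<partial>lborel)"
    by (rule nn_integral_mean_nodal_count_large[symmetric]) (simp add: T_def)
  finally show ?thesis .
qed

end

section \<open>Limits of the normalised counts\<close>

lemma abs_diff_ennreal:
  "0 \<le> r \<Longrightarrow> e2ennreal \<bar>enn2ereal (ennreal r) - ereal a\<bar> = ennreal \<bar>r - a\<bar>"
  by (simp add: e2ennreal_ereal)

lemma abs_diff_top: "e2ennreal \<bar>enn2ereal top - ereal a\<bar> = top"
  by (simp add: top_ennreal.rep_eq)

text \<open>Two halves of the triangle inequality, in additive form so that an infinite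
  \<open>x\<close> is allowed.\<close>

lemma le_abs_diff_plus:
  assumes "0 \<le> a"
  shows "x \<le> e2ennreal \<bar>enn2ereal x - ereal a\<bar> + ennreal a"
    and "ennreal a \<le> e2ennreal \<bar>enn2ereal x - ereal a\<bar> + x"
  using assms
  by (cases x; simp add: abs_diff_ennreal abs_diff_top flip: ennreal_plus)+

text \<open>Meant for \<open>x\<close> the normalised count of small domains, \<open>y\<close> that
  of large ones and \<open>p = \<Psi> t\<close>: the way from \<open>x + y\<close> to 1 through
  \<open>p\<close> costs \<open>y\<close> and \<open>1 - p\<close>.\<close>

lemma abs_diff_add_le:
  assumes "0 \<le> p" "p \<le> 1"
  shows "e2ennreal \<bar>enn2ereal (x + y) - ereal 1\<bar> \<le>
    e2ennreal \<bar>enn2ereal x - ereal p\<bar> + y + ennreal (1 - p)"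
proof (cases x; cases y)
  fix r s assume *: "x = ennreal r" "0 \<le> r" "y = ennreal s" "0 \<le> s"
  then have "e2ennreal \<bar>enn2ereal (x + y) - ereal 1\<bar> = ennreal \<bar>r + s - 1\<bar>"
    using abs_diff_ennreal[of "r + s" 1] by simp
  also have "\<dots> \<le> ennreal (\<bar>r - p\<bar> + s + (1 - p))" using * assms by (intro ennreal_leI) linarith
  also have "\<dots> = e2ennreal \<bar>enn2ereal x - ereal p\<bar> + y + ennreal (1 - p)"
    using * assms by (simp add: abs_diff_ennreal)
  finally show ?thesis .
qed (auto simp: abs_diff_top)

text \<open>The expectation is squeezed between \<open>a\<close> minus and \<open>a\<close> plus the
  mean distance; truncated subtraction does no harm to the lower bound near the limit.\<close>

lemma (in prob_space) nn_integral_tendsto_of_mean_abs_diff: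
  assumes [measurable]: "\<And>i. X i \<in> borel_measurable M" and "0 \<le> a"
    and lim: "((\<lambda>i. mean_abs_diff M (X i) a) \<longlongrightarrow> 0) G"
  shows "((\<lambda>i. \<integral>\<^sup>+\<omega>. X i \<omega> \<partial>M) \<longlongrightarrow> ennreal a) G"
proof (rule tendsto_sandwich)
  let ?d = "\<lambda>i. mean_abs_diff M (X i) a"
  have "(\<integral>\<^sup>+\<omega>. X i \<omega> \<partial>M) \<le> ennreal a + ?d i" for i
  proof -
    have "(\<integral>\<^sup>+\<omega>. X i \<omega> \<partial>M) \<le> (\<integral>\<^sup>+\<omega>. e2ennreal \<bar>enn2ereal (X i \<omega>) - ereal a\<bar> + ennreal a \<partial>M)"
      by (intro nn_integral_mono le_abs_diff_plus assms)
    also have "\<dots> = ?d i + ennreal a"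
      unfolding mean_abs_diff_def by (subst nn_integral_add) (auto simp: emeasure_space_1)
    finally show ?thesis by (simp add: add.commute)
  qed
  then show "\<forall>\<^sub>F i in G. (\<integral>\<^sup>+\<omega>. X i \<omega> \<partial>M) \<le> ennreal a + ?d i" by simp
  have "ennreal a - ?d i \<le> (\<integral>\<^sup>+\<omega>. X i \<omega> \<partial>M)" for i
  proof -
    have "ennreal a = (\<integral>\<^sup>+\<omega>. ennreal a \<partial>M)" by (simp add: emeasure_space_1)
    also have "\<dots> \<le> (\<integral>\<^sup>+\<omega>. e2ennreal \<bar>enn2ereal (X i \<omega>) - ereal a\<bar> + X i \<omega> \<partial>M)"
      by (intro nn_integral_mono le_abs_diff_plus assms)
    also have "\<dots> = ?d i + (\<integral>\<^sup>+\<omega>. X i \<omega> \<partial>M)"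
      unfolding mean_abs_diff_def by (subst nn_integral_add) auto
    finally show ?thesis by (simp add: ennreal_minus_le_iff add.commute)
  qed
  then show "\<forall>\<^sub>F i in G. ennreal a - ?d i \<le> (\<integral>\<^sup>+\<omega>. X i \<omega> \<partial>M)" by simp
  show "((\<lambda>i. ennreal a + ?d i) \<longlongrightarrow> ennreal a) G"
    using tendsto_add[OF tendsto_const lim, of "ennreal a"] by simp
  show "((\<lambda>i. ennreal a - ?d i) \<longlongrightarrow> ennreal a) G"
    using tendsto_diff_ennreal[OF tendsto_const lim, of "ennreal a"] by simp
qed

lemma measure_ball_pos:
  "0 < R \<Longrightarrow> 0 < measure lborel (ball (0::'a::euclidean_space) R)"
  by (simp add: content_ball)

text \<open>\<open>\<Psi>\<close> is prescribed only on the positive axis. Replacing it by a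
  distribution function on the whole line gives access to monotonicity, and continuity transfers
  because it is local.\<close>

lemma positive_cdf_obtain:
  assumes "positive_cdf \<Psi>"
  obtains \<Phi> where "mono \<Phi>" "\<And>t. 0 \<le> \<Phi> t" "\<And>t. \<Phi> t \<le> 1" "(\<Phi> \<longlongrightarrow> 1) at_top"
    "\<And>t. 0 < t \<Longrightarrow> \<Psi> t = \<Phi> t" "\<And>t. 0 < t \<Longrightarrow> isCont \<Psi> t \<longleftrightarrow> isCont \<Phi> t"
proof -
  obtain \<mu> where \<mu>: "real_distribution \<mu>" "\<And>t. 0 < t \<Longrightarrow> \<Psi> t = cdf \<mu> t"
    using assms unfolding positive_cdf_def by blast
  interpret \<mu>: real_distribution \<mu> by fact
  show ?thesis
  proof (rule that[of "cdf \<mu>"])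
    show "isCont \<Psi> t \<longleftrightarrow> isCont (cdf \<mu>) t" if "0 < t" for t
    proof (rule isCont_cong)
      show "\<forall>\<^sub>F x in nhds t. \<Psi> x = cdf \<mu> x"
        using eventually_nhds_in_open[of "{0<..}" t] that
        by (auto elim!: eventually_mono simp: \<mu>(2))
    qed
  qed (auto simp: mono_def \<mu>.cdf_nondecreasing \<mu>.cdf_nonneg \<mu>.cdf_bounded_prob
      \<mu>.cdf_lim_at_top_prob \<mu>(2))
qed

lemma ennreal_divide_mult_real:
  assumes "0 < c" "0 < v"
  shows "x / ennreal (c * v) = ennreal (1 / c) * (x / ennreal v)"
proof (cases x)
  case (real r)
  then show ?thesis using assms by (simp add: divide_ennreal ennreal_mult[symmetric])
next
  case top
  then show ?thesis using assms by (simp add: ennreal_top_divide ennreal_mult_top)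
qed

locale nodal_asymptotics = continuous_stationary_field M F
  for M :: "'w measure" and F :: "'a::euclidean_space \<Rightarrow> 'w \<Rightarrow> real" +
  fixes c :: real and \<Psi> :: "real \<Rightarrow> real"
  assumes c_pos: "0 < c"
    and ns_constant: "nazarov_sodin_constant M F c"
    and limit_volume: "limit_volume_distribution M F c \<Psi>"
begin

lemma mean_count_tendsto:
  "((\<lambda>R. \<integral>\<^sup>+\<omega>. nodal_count (path \<omega>) R / ennreal (c * measure lborel (ball (0::'a) R)) \<partial>M) \<longlongrightarrow> 1) at_top"
proof -
  have "((\<lambda>R. ennreal (1 / c) * ((\<integral>\<^sup>+\<omega>. nodal_count (path \<omega>) R \<partial>M) / ennreal (measure lborel (ball (0::'a) R))))
      \<longlongrightarrow> ennreal (1 / c) * ennreal c) at_top"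
    using ns_constant unfolding nazarov_sodin_constant_def
    by (intro ennreal_tendsto_cmult) auto
  moreover have "ennreal (1 / c) * ennreal c = 1"
    using c_pos by (simp flip: ennreal_mult)
  moreover have "\<forall>\<^sub>F R in at_top. ennreal (1 / c) * ((\<integral>\<^sup>+\<omega>. nodal_count (path \<omega>) R \<partial>M) / ennreal (measure lborel (ball (0::'a) R))) =
      (\<integral>\<^sup>+\<omega>. nodal_count (path \<omega>) R / ennreal (c * measure lborel (ball (0::'a) R)) \<partial>M)"
    using eventually_gt_at_top[of 0]
    by eventually_elim
      (simp add: nn_integral_divide nn_integral_cmult ennreal_divide_mult_real[OF c_pos measure_ball_pos])
  ultimately show ?thesis by (simp add: Lim_transform_eventually)
qed

lemma count_vol_mean_abs_diff_tendsto:
  assumes "0 < t" "isCont \<Psi> t"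
  shows "((\<lambda>R. mean_abs_diff M (\<lambda>\<omega>. nodal_count_vol (path \<omega>) t R / ennreal (c * measure lborel (ball (0::'a) R))) (\<Psi> t))
    \<longlongrightarrow> 0) at_top"
  using limit_volume assms unfolding limit_volume_distribution_def by blast

lemma limit_volume_bounds: "0 < t \<Longrightarrow> 0 \<le> \<Psi> t" "0 < t \<Longrightarrow> \<Psi> t \<le> 1"
  using limit_volume positive_cdf_obtain[of \<Psi>]
  unfolding limit_volume_distribution_def by metis+

text \<open>The counterpart at radius \<open>R\<close> of the survival function
  \<open>1 - \<Psi> t\<close>.\<close>

definition mean_large :: "real \<Rightarrow> real \<Rightarrow> ennreal" where
  "mean_large t R = (\<integral>\<^sup>+\<omega>. nodal_count_large (path \<omega>) t R / ennreal (c * measure lborel (ball (0::'a) R)) \<partial>M)"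

lemma count_split:
  "nodal_count (path \<omega>) R / ennreal (c * measure lborel (ball (0::'a) R)) =
    nodal_count_vol (path \<omega>) t R / ennreal (c * measure lborel (ball (0::'a) R)) + nodal_count_large (path \<omega>) t R / ennreal (c * measure lborel (ball (0::'a) R))"
  by (simp add: nodal_count_split[of _ _ t] add_divide_distrib_ennreal)

text \<open>The normalised mean of all domains tends to 1 and that of the small ones to
  \<open>\<Psi> t\<close>; the large ones are the difference.\<close>

lemma mean_large_tendsto:
  assumes "0 < t" "isCont \<Psi> t"
  shows "((\<lambda>R. mean_large t R) \<longlongrightarrow> ennreal (1 - \<Psi> t)) at_top"
proof -
  let ?m = "\<lambda>R. \<integral>\<^sup>+\<omega>. nodal_count_vol (path \<omega>) t R / ennreal (c * measure lborel (ball (0::'a) R)) \<partial>M"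
  let ?n = "\<lambda>R. \<integral>\<^sup>+\<omega>. nodal_count (path \<omega>) R / ennreal (c * measure lborel (ball (0::'a) R)) \<partial>M"
  have m: "(?m \<longlongrightarrow> ennreal (\<Psi> t)) at_top"
    by (intro nn_integral_tendsto_of_mean_abs_diff count_vol_mean_abs_diff_tendsto assms
      limit_volume_bounds) measurable
  have "((\<lambda>R. ?n R - ?m R) \<longlongrightarrow> 1 - ennreal (\<Psi> t)) at_top"
    using mean_count_tendsto m by (rule tendsto_diff_ennreal) auto
  moreover have "1 - ennreal (\<Psi> t) = ennreal (1 - \<Psi> t)"
    using limit_volume_bounds[OF assms(1)] by (simp add: ennreal_minus flip: ennreal_1)
  moreover have "\<forall>\<^sub>F R in at_top. ?n R - ?m R = mean_large t R"
  proof -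
    \<comment> \<open>Cancelling \<open>?m R\<close> in \<open>ennreal\<close> requires it to be
      finite, which the finite limit ensures eventually.\<close>
    have "\<forall>\<^sub>F R in at_top. ?m R < top" using m by (rule order_tendstoD) simp
    then show ?thesis
    proof eventually_elim
      case (elim R)
      have "?n R = ?m R + mean_large t R"
        unfolding mean_large_def
        by (subst nn_integral_add[symmetric]) (auto simp: count_split[of _ R t])
      then show ?case using elim by (simp add: ennreal_add_diff_cancel_left less_top)
    qed
  qed
  ultimately show ?thesis by (simp add: Lim_transform_eventually)
qed

text \<open>Convergence of expectations is upgraded to convergence in mean. The small domains
  converge in mean by the definition of \<open>\<Psi>\<close>, and the large ones form a nonnegative
  part whose mean is small once \<open>t\<close> is large.\<close>

lemma count_mean_abs_diff_tendsto:
  "((\<lambda>R. mean_abs_diff M (\<lambda>\<omega>. nodal_count (path \<omega>) R / ennreal (c * measure lborel (ball (0::'a) R))) 1) \<longlongrightarrow> 0) at_top"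
proof (rule order_tendstoI)
  fix a :: ennreal assume "0 < a"
  then obtain e where e: "0 < e" "ennreal e < a"
    by (metis dense ennreal_cases ennreal_less_zero_iff less_top order_less_trans top.not_eq_extremum)
  obtain \<Phi> where \<Phi>: "mono \<Phi>" "(\<Phi> \<longlongrightarrow> 1) at_top" "\<And>t. 0 < t \<Longrightarrow> \<Psi> t = \<Phi> t"
      "\<And>t. 0 < t \<Longrightarrow> isCont \<Psi> t \<longleftrightarrow> isCont \<Phi> t"
    using limit_volume positive_cdf_obtain[of \<Psi>] unfolding limit_volume_distribution_def by metis
  \<comment> \<open>Half of \<open>e\<close>, because \<open>1 - \<Psi> t\<close> enters the final
    bound twice: as the limit of \<open>mean_large t\<close> and as the distance from
    \<open>\<Psi> t\<close> to 1.\<close>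
  have "\<forall>\<^sub>F t in at_top. 1 - e / 2 < \<Phi> t" using \<Phi>(2) e(1) by (intro order_tendstoD) auto
  then obtain t0 where t0: "\<And>t. t0 \<le> t \<Longrightarrow> 1 - e / 2 < \<Phi> t" by (auto simp: eventually_at_top_linorder)
  \<comment> \<open>A monotone function has countably many discontinuities, so this interval
    contains a continuity point; the maximum with 1 makes it positive.\<close>
  have "\<not> {max 1 t0<..<max 1 t0 + 1} \<subseteq> {t. \<not> isCont \<Phi> t}"
    using mono_ctble_discont[OF \<Phi>(1)] countable_subset uncountable_open_interval by (metis less_add_one)
  then obtain t where "t \<in> {max 1 t0<..<max 1 t0 + 1}" and t: "isCont \<Phi> t" by blast
  then have "max 1 t0 < t" by simp
  then have t': "0 < t" "isCont \<Psi> t" "1 - \<Psi> t < e / 2" 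
    using t \<Phi>(3,4)[of t] t0[of t] by auto
  define v where "v R = mean_abs_diff M (\<lambda>\<omega>. nodal_count_vol (path \<omega>) t R / ennreal (c * measure lborel (ball (0::'a) R))) (\<Psi> t)"
    for R
  have "((\<lambda>R. v R + mean_large t R + ennreal (1 - \<Psi> t))
      \<longlongrightarrow> 0 + ennreal (1 - \<Psi> t) + ennreal (1 - \<Psi> t)) at_top"
    unfolding v_def using t'
    by (intro tendsto_add tendsto_const mean_large_tendsto count_vol_mean_abs_diff_tendsto)
  moreover have "0 + ennreal (1 - \<Psi> t) + ennreal (1 - \<Psi> t) < a"
  proof -
    have "0 + ennreal (1 - \<Psi> t) + ennreal (1 - \<Psi> t) = ennreal (2 * (1 - \<Psi> t))"
      using limit_volume_bounds[OF t'(1)] by (simp flip: ennreal_plus)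
    also have "\<dots> \<le> ennreal e" using t'(3) by (intro ennreal_leI) simp
    finally show ?thesis using e(2) by simp
  qed
  ultimately have "\<forall>\<^sub>F R in at_top. v R + mean_large t R + ennreal (1 - \<Psi> t) < a"
    by (rule order_tendstoD)
  then show "\<forall>\<^sub>F R in at_top.
      mean_abs_diff M (\<lambda>\<omega>. nodal_count (path \<omega>) R / ennreal (c * measure lborel (ball (0::'a) R))) 1 < a"
  proof eventually_elim
    case (elim R)
    have "mean_abs_diff M (\<lambda>\<omega>. nodal_count (path \<omega>) R / ennreal (c * measure lborel (ball (0::'a) R))) 1
      \<le> (\<integral>\<^sup>+\<omega>. e2ennreal \<bar>enn2ereal (nodal_count_vol (path \<omega>) t R / ennreal (c * measure lborel (ball (0::'a) R))) - ereal (\<Psi> t)\<bar>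
          + nodal_count_large (path \<omega>) t R / ennreal (c * measure lborel (ball (0::'a) R)) + ennreal (1 - \<Psi> t) \<partial>M)"
      unfolding mean_abs_diff_def count_split[of _ R t]
      by (intro nn_integral_mono abs_diff_add_le limit_volume_bounds t')
    also have "\<dots> = v R + mean_large t R + ennreal (1 - \<Psi> t)"
      unfolding v_def mean_abs_diff_def mean_large_def
      by (simp add: nn_integral_add emeasure_space_1)
    finally show ?case using elim by simp
  qed
qed simp

end

section \<open>The mean of the limit volume distribution\<close>

text \<open>The boundary layer of width \<open>L\<close> lost in the lower volume bound is
  negligible, as volumes scale with the power \<open>DIM('a)\<close> of the radius.\<close>

lemma tendsto_ball_volume_ratio:
  "(\<lambda>n. measure lborel (ball (0::'a::euclidean_space) (real n - L)) / measure lborel (ball (0::'a) (real n)))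
    \<longlonglongrightarrow> 1"
proof (rule Lim_transform_eventually)
  show "(\<lambda>n. (1 - L / real n) ^ DIM('a)) \<longlonglongrightarrow> 1"
    using tendsto_power[OF tendsto_diff[OF tendsto_const lim_const_over_n[of L]], of 1 "DIM('a)"] by simp
  obtain m :: nat where m: "max L 0 < real m" using reals_Archimedean2 by blast
  show "\<forall>\<^sub>F n in sequentially. (1 - L / real n) ^ DIM('a) =
      measure lborel (ball (0::'a) (real n - L)) / measure lborel (ball (0::'a) (real n))"
    using eventually_ge_at_top[of m]
  proof eventually_elim
    case (elim n)
    then have n: "L < real n" "0 < real n" using m by auto
    then have "1 - L / real n = (real n - L) / real n" by (simp add: field_simps)
    moreover have "unit_ball_vol (real DIM('a)) \<noteq> 0"
      using unit_ball_vol_pos[of "real DIM('a)"] by linarith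
    ultimately show ?case using n by (simp add: content_ball power_divide)
  qed
qed

context nodal_asymptotics
begin

lemma mean_large_le: "mean_large t R \<le> (\<integral>\<^sup>+\<omega>. nodal_count (path \<omega>) R / ennreal (c * measure lborel (ball (0::'a) R)) \<partial>M)"
  unfolding mean_large_def by (intro nn_integral_mono) (simp add: count_split[of _ R t])

lemma mean_large_eq:
  "mean_large t R = (\<integral>\<^sup>+\<omega>. nodal_count_large (path \<omega>) t R \<partial>M) / ennreal (c * measure lborel (ball (0::'a) R))"
  unfolding mean_large_def by (rule nn_integral_divide) measurable

lemma measurable_mean_large [measurable]: "(\<lambda>t. mean_large t R) \<in> borel_measurable lborel"
  unfolding mean_large_eq by measurable

lemma measurable_survival [measurable]:
  "(\<lambda>t. indicator {0<..} t * ennreal (1 - \<Psi> t)) \<in> borel_measurable lborel"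
proof -
  obtain \<Phi> :: "real \<Rightarrow> real" where \<Phi>: "mono \<Phi>" "\<And>t. 0 < t \<Longrightarrow> \<Psi> t = \<Phi> t"
    using limit_volume positive_cdf_obtain[of \<Psi>] unfolding limit_volume_distribution_def by metis
  have [measurable]: "\<Phi> \<in> borel_measurable borel" using \<Phi>(1) by (rule borel_measurable_mono)
  have "(\<lambda>t. indicator {0<..} t * ennreal (1 - \<Phi> t)) \<in> borel_measurable lborel" by measurable
  moreover have "(\<lambda>t. indicator {0<..} t * ennreal (1 - \<Psi> t)) = (\<lambda>t. indicator {0<..} t * ennreal (1 - \<Phi> t))"
    using \<Phi>(2) by (auto simp: indicator_def fun_eq_iff)
  ultimately show ?thesis by simp
qed

text \<open>Discontinuities of a monotone function are countable, hence Lebesgue null; convergence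
  at continuity points is thus convergence at almost every threshold.\<close>

lemma AE_isCont_limit_volume: "AE t in lborel. 0 < t \<longrightarrow> isCont \<Psi> t"
proof -
  obtain \<Phi> :: "real \<Rightarrow> real" where \<Phi>: "mono \<Phi>" "\<And>t. 0 < t \<Longrightarrow> isCont \<Psi> t \<longleftrightarrow> isCont \<Phi> t"
    using limit_volume positive_cdf_obtain[of \<Psi>] unfolding limit_volume_distribution_def by metis
  have "{t. \<not> isCont \<Phi> t} \<in> null_sets lborel"
    using mono_ctble_discont[OF \<Phi>(1)] by (rule countable_imp_null_set_lborel)
  then show ?thesis by (rule AE_I') (use \<Phi>(2) in auto)
qed

lemma truncated_mean_tendsto:
  fixes T :: real
  shows "(\<lambda>n. \<integral>\<^sup>+t. indicator {0<..<T} t * mean_large t (real n) \<partial>lborel) \<longlonglongrightarrow>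
    (\<integral>\<^sup>+t. indicator {0<..<T} t * ennreal (1 - \<Psi> t) \<partial>lborel)"
proof -
  \<comment> \<open>Any finite bound above the limit 1 would serve in place of 2. By
    \<open>mean_large_le\<close> it dominates \<open>mean_large t R\<close> for all \<open>t\<close>
    simultaneously.\<close>
  have "\<forall>\<^sub>F R in at_top. (\<integral>\<^sup>+\<omega>. nodal_count (path \<omega>) R / ennreal (c * measure lborel (ball (0::'a) R)) \<partial>M) < 2"
    using mean_count_tendsto by (rule order_tendstoD) simp
  then obtain R0 where R0: "\<And>R. R0 \<le> R \<Longrightarrow>
      (\<integral>\<^sup>+\<omega>. nodal_count (path \<omega>) R / ennreal (c * measure lborel (ball (0::'a) R)) \<partial>M) < 2"
    by (auto simp: eventually_at_top_linorder)
  obtain n0 :: nat where n0: "R0 \<le> real n0" using real_arch_simple by blast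
  have [measurable]: "(\<lambda>t. indicator {0<..<T} t * ennreal (1 - \<Psi> t)) \<in> borel_measurable lborel"
  proof -
    have "(\<lambda>t. indicator {..<T} t * (indicator {0<..} t * ennreal (1 - \<Psi> t))) \<in> borel_measurable lborel"
      by measurable
    moreover have "(\<lambda>t. indicator {..<T} t * (indicator {0<..} t * ennreal (1 - \<Psi> t))) =
        (\<lambda>t. indicator {0<..<T} t * ennreal (1 - \<Psi> t))"
      by (auto simp: indicator_def fun_eq_iff)
    ultimately show ?thesis by (simp only:)
  qed
  \<comment> \<open>The shift by \<open>n0\<close> makes the domination hold for every term;
    \<open>LIMSEQ_offset\<close> removes it at the end.\<close>
  have "(\<lambda>n. \<integral>\<^sup>+t. indicator {0<..<T} t * mean_large t (real (n + n0)) \<partial>lborel) \<longlonglongrightarrow>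
    (\<integral>\<^sup>+t. indicator {0<..<T} t * ennreal (1 - \<Psi> t) \<partial>lborel)"
  proof (rule nn_integral_dominated_convergence[where w = "\<lambda>t. 2 * indicator {0<..<T} t"])
    show "AE t in lborel. indicator {0<..<T} t * mean_large t (real (n + n0)) \<le> 2 * indicator {0<..<T} t" for n
      using order_trans[OF mean_large_le less_imp_le[OF R0[of "real (n + n0)"]]] n0
      by (intro AE_I2) (auto simp: indicator_def)
    have "(\<integral>\<^sup>+t. 2 * indicator {0<..<T} t \<partial>lborel) = 2 * emeasure lborel {0<..<T}"
      by (rule nn_integral_cmult_indicator) simp
    also have "\<dots> < \<infinity>" by (cases "0 \<le> T") (auto simp: ennreal_mult_less_top)
    finally show "(\<integral>\<^sup>+t. 2 * indicator {0<..<T} t \<partial>lborel) < \<infinity>" .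
    show "AE t in lborel. (\<lambda>n. indicator {0<..<T} t * mean_large t (real (n + n0))) \<longlonglongrightarrow>
        indicator {0<..<T} t * ennreal (1 - \<Psi> t)"
      using AE_isCont_limit_volume
    proof eventually_elim
      case (elim t)
      show ?case
      proof (cases "0 < t")
        case True
        have "filterlim (\<lambda>n. real (n + n0)) at_top sequentially"
          by (rule filterlim_compose[OF filterlim_real_sequentially filterlim_add_const_nat_at_top])
        then have "(\<lambda>n. mean_large t (real (n + n0))) \<longlonglongrightarrow> ennreal (1 - \<Psi> t)"
          using elim True by (intro filterlim_compose[OF mean_large_tendsto]) auto
        then show ?thesis by (intro ennreal_tendsto_cmult) (auto simp: indicator_def)
      qed simp
    qed
  qed measurable
  then show ?thesis by (rule LIMSEQ_offset)
qed

lemma truncated_mean_eq: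
  "(\<integral>\<^sup>+t. indicator {0<..<T} t * mean_large t R \<partial>lborel) =
    (\<integral>\<^sup>+t. indicator {0<..<T} t * (\<integral>\<^sup>+\<omega>. nodal_count_large (path \<omega>) t R \<partial>M) \<partial>lborel) /
      ennreal (c * measure lborel (ball (0::'a) R))"
  unfolding mean_large_eq ennreal_times_divide by (rule nn_integral_divide) measurable

lemma truncated_survival_upper:
  assumes "0 \<le> T"
  shows "(\<integral>\<^sup>+t. indicator {0<..<T} t * ennreal (1 - \<Psi> t) \<partial>lborel) \<le> ennreal (bounded_prob / c)"
proof (rule tendsto_upperbound[OF truncated_mean_tendsto])
  show "\<forall>\<^sub>F n in sequentially. (\<integral>\<^sup>+t. indicator {0<..<T} t * mean_large t (real n) \<partial>lborel) \<le> ennreal (bounded_prob / c)"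
    using eventually_gt_at_top[of 0]
  proof eventually_elim
    case (elim n)
    let ?v = "measure lborel (ball (0::'a) (real n))"
    have v: "0 < ?v" using elim by (intro measure_ball_pos) simp
    have "(\<integral>\<^sup>+t. indicator {0<..<T} t * mean_large t (real n) \<partial>lborel) \<le>
        ennreal bounded_prob * emeasure lborel (ball (0::'a) (real n)) / ennreal (c * ?v)"
      unfolding truncated_mean_eq by (intro divide_right_mono_ennreal mean_volume_upper assms)
    also have "\<dots> = ennreal (bounded_prob / c)"
      using v c_pos
      by (simp add: emeasure_lborel_subset_ball[OF order_refl] bounded_prob_def divide_ennreal
        flip: ennreal_mult)
    finally show ?case .
  qed
qed simp

text \<open>\<open>L\<close>, and with it \<open>T\<close>, stays fixed while the radius of the
  observation ball tends to infinity.\<close>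

lemma truncated_survival_lower:
  fixes L :: real
  defines "T \<equiv> measure lborel (ball (0::'a) L)"
  shows "ennreal (local_prob L / c) \<le> (\<integral>\<^sup>+t. indicator {0<..<T} t * ennreal (1 - \<Psi> t) \<partial>lborel)"
proof (rule LIMSEQ_le[OF _ truncated_mean_tendsto])
  let ?v = "\<lambda>r. measure lborel (ball (0::'a) r)"
  show "(\<lambda>n. ennreal (local_prob L / c * (?v (real n - L) / ?v (real n)))) \<longlonglongrightarrow> ennreal (local_prob L / c)"
    using tendsto_mult[OF tendsto_const tendsto_ball_volume_ratio[of L, where 'a = 'a], of "local_prob L / c"]
    by (intro tendsto_ennrealI) simp
  have "ennreal (local_prob L / c * (?v (real n - L) / ?v (real n)))
      \<le> (\<integral>\<^sup>+t. indicator {0<..<T} t * mean_large t (real n) \<partial>lborel)" if "1 \<le> n" for n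
  proof -
    have v: "0 < ?v (real n)" using that by (intro measure_ball_pos) simp
    have "ennreal (local_prob L / c * (?v (real n - L) / ?v (real n))) =
        ennreal (local_prob L) * emeasure lborel (ball (0::'a) (real n - L)) / ennreal (c * ?v (real n))"
      using v c_pos
      by (simp add: emeasure_lborel_subset_ball[OF order_refl] local_prob_def divide_ennreal
        flip: ennreal_mult)
    also have "\<dots> \<le> (\<integral>\<^sup>+t. indicator {0<..<T} t * mean_large t (real n) \<partial>lborel)"
      unfolding truncated_mean_eq T_def by (intro divide_right_mono_ennreal mean_volume_lower)
    finally show ?thesis .
  qed
  then show "\<exists>N. \<forall>n\<ge>N. ennreal (local_prob L / c * (?v (real n - L) / ?v (real n)))
      \<le> (\<integral>\<^sup>+t. indicator {0<..<T} t * mean_large t (real n) \<partial>lborel)" by blast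
qed

text \<open>The upper bound is uniform in the truncation level and passes to the limit by monotone
  convergence. The lower bound uses the volumes of balls of integer radius as levels, together with
  \<open>local_prob_tendsto\<close>.\<close>

lemma nn_integral_survival:
  "(\<integral>\<^sup>+t. indicator {0<..} t * ennreal (1 - \<Psi> t) \<partial>lborel) = ennreal (bounded_prob / c)"
    (is "?I = _")
proof (rule antisym)
  have "?I = (\<integral>\<^sup>+t. (SUP n. indicator {..<real n} t * (indicator {0<..} t * ennreal (1 - \<Psi> t))) \<partial>lborel)"
  proof (intro nn_integral_cong antisym SUP_least)
    fix t :: real
    obtain n :: nat where "t < real n" using reals_Archimedean2 by blast
    then show "indicator {0<..} t * ennreal (1 - \<Psi> t)
        \<le> (SUP n. indicator {..<real n} t * (indicator {0<..} t * ennreal (1 - \<Psi> t)))"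
      by (intro SUP_upper2[of n]) auto
  qed (auto simp: indicator_def)
  also have "\<dots> = (SUP n. \<integral>\<^sup>+t. indicator {..<real n} t * (indicator {0<..} t * ennreal (1 - \<Psi> t)) \<partial>lborel)"
  proof (rule nn_integral_monotone_convergence_SUP)
    show "incseq (\<lambda>n t. indicator {..<real n} t * (indicator {0<..} t * ennreal (1 - \<Psi> t)))"
      by (auto simp: incseq_def le_fun_def indicator_def)
  qed measurable
  also have "\<dots> \<le> ennreal (bounded_prob / c)"
  proof (rule SUP_least)
    fix n :: nat
    have "(\<integral>\<^sup>+t. indicator {..<real n} t * (indicator {0<..} t * ennreal (1 - \<Psi> t)) \<partial>lborel) =
        (\<integral>\<^sup>+t. indicator {0<..<real n} t * ennreal (1 - \<Psi> t) \<partial>lborel)"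
      by (intro nn_integral_cong) (auto simp: indicator_def)
    then show "(\<integral>\<^sup>+t. indicator {..<real n} t * (indicator {0<..} t * ennreal (1 - \<Psi> t)) \<partial>lborel)
        \<le> ennreal (bounded_prob / c)"
      using truncated_survival_upper[of "real n"] by simp
  qed
  finally show "?I \<le> ennreal (bounded_prob / c)" .
  have "ennreal (local_prob (real n) / c) \<le> ?I" for n
    by (rule order_trans[OF truncated_survival_lower]) (intro nn_integral_mono, auto simp: indicator_def)
  moreover have "(\<lambda>n. ennreal (local_prob (real n) / c)) \<longlonglongrightarrow> ennreal (bounded_prob / c)"
    by (intro tendsto_ennrealI tendsto_divide local_prob_tendsto tendsto_const) (use c_pos in simp)
  ultimately show "ennreal (bounded_prob / c) \<le> ?I"
    by (intro LIMSEQ_le_const2) auto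
qed

lemma survival_has_integral: "((\<lambda>t. 1 - \<Psi> t) has_integral bounded_prob / c) {0<..}"
proof -
  let ?f = "\<lambda>t. if t \<in> {0<..} then 1 - \<Psi> t else 0"
  have eq: "ennreal (?f t) = indicator {0<..} t * ennreal (1 - \<Psi> t)" for t by simp
  have nonneg: "0 \<le> ?f t" for t using limit_volume_bounds[of t] by simp
  \<comment> \<open>Measurability of the real-valued extension by zero is recovered from the
    \<open>ennreal\<close> version, since \<open>enn2real\<close> inverts \<open>ennreal\<close> on
    nonnegative values.\<close>
  have "(\<lambda>t. enn2real (indicator {0<..} t * ennreal (1 - \<Psi> t))) \<in> borel_measurable lborel" by measurable
  then have "?f \<in> borel_measurable borel"
    unfolding eq[symmetric] by (simp only: enn2real_ennreal nonneg measurable_lborel2)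
  moreover have "(\<integral>\<^sup>+t. ennreal (?f t) \<partial>lborel) = ennreal (bounded_prob / c)"
    by (simp only: eq nn_integral_survival)
  moreover have "0 \<le> bounded_prob / c" using c_pos by (simp add: bounded_prob_def)
  ultimately have "(?f has_integral bounded_prob / c) UNIV"
    using nonneg by (intro nn_integral_has_integral)
  then show ?thesis by (simp only: has_integral_restrict_UNIV)
qed

end

section \<open>The empirical volume mean\<close>

text \<open>Integrality of counts is what bounds the empirical volume mean by the volume of the
  ball.\<close>

lemma emeasure_count_space_ge_1:
  assumes "0 < emeasure (count_space UNIV) S"
  shows "1 \<le> emeasure (count_space UNIV) S"
proof -
  obtain x where "x \<in> S" using assms by (cases "S = {}") auto
  then have "emeasure (count_space UNIV) {x} \<le> emeasure (count_space UNIV) S"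
    by (intro emeasure_mono) auto
  then show ?thesis by simp
qed

text \<open>For finite \<open>n\<close>, the difference \<open>v / n - 1 / c\<close> equals
  \<open>v / n\<close> times \<open>1 - n / (c * v)\<close>, and the hypothesis bounds the factor
  \<open>v / n\<close> by \<open>2 / c\<close>.\<close>

lemma abs_diff_inverse_count_le:
  fixes n :: ennreal and c v :: real
  assumes "0 < c" "0 < v" "c / 2 \<le> n / ennreal v"
  shows "e2ennreal \<bar>enn2ereal (ennreal v / n * indicator {0<..} n) - ereal (1 / c)\<bar>
    \<le> ennreal (2 / c) * e2ennreal \<bar>enn2ereal (n / ennreal (c * v)) - ereal 1\<bar>"
proof (cases n)
  case (real r)
  then have "c / 2 \<le> r / v" using assms by (simp add: divide_ennreal del: ennreal_half)
  then have r: "c * v / 2 \<le> r" using assms by (simp add: field_simps)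
  then have r_pos: "0 < r" using assms by (smt (verit) half_gt_zero mult_pos_pos)
  have "v / r - 1 / c = (v / r) * (1 - r / (c * v))" using assms r_pos by (simp add: field_simps)
  then have "\<bar>v / r - 1 / c\<bar> = (v / r) * \<bar>r / (c * v) - 1\<bar>"
    using assms r_pos by (simp add: abs_mult)
  also have "\<dots> \<le> (2 / c) * \<bar>r / (c * v) - 1\<bar>"
    using assms r r_pos by (intro mult_right_mono) (auto simp: field_simps)
  finally have "ennreal \<bar>v / r - 1 / c\<bar> \<le> ennreal (2 / c) * ennreal \<bar>r / (c * v) - 1\<bar>"
    using assms by (simp add: ennreal_leI flip: ennreal_mult)
  then show ?thesis
    using real assms r_pos by (simp add: divide_ennreal abs_diff_ennreal)
next
  \<comment> \<open>An infinite count makes the left side \<open>1 / c\<close> and the right side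
    infinite.\<close>
  case top
  then show ?thesis using assms by (simp add: ennreal_top_divide abs_diff_top[simplified] ennreal_mult_top)
qed

text \<open>At \<open>n = 0\<close> the indicator multiplies an infinite quotient by 0, and the
  product is 0 in \<open>ennreal\<close>; for \<open>n \<ge> 1\<close> the quotient is at most
  \<open>v\<close>.\<close>

lemma abs_diff_inverse_count_le':
  fixes n :: ennreal and c v :: real
  assumes "0 < c" "0 < v" "n = 0 \<or> 1 \<le> n"
  shows "e2ennreal \<bar>enn2ereal (ennreal v / n * indicator {0<..} n) - ereal (1 / c)\<bar> \<le> ennreal (v + 1 / c)"
proof -
  have "ennreal v / n * indicator {0<..} n \<le> ennreal v"
  proof (cases "n = 0")
    case False
    then have "ennreal v * 1 \<le> ennreal v * n" using assms by (intro mult_left_mono) auto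
    then have "ennreal v / n \<le> ennreal v"
      using False by (intro divide_le_posI_ennreal) (auto simp: zero_less_iff_neq_zero mult.commute)
    then show ?thesis by (simp add: indicator_def)
  qed simp
  then obtain y where y: "ennreal v / n * indicator {0<..} n = ennreal y" "0 \<le> y" "y \<le> v"
    using assms by (metis ennreal_cases ennreal_le_iff ennreal_less_top leD less_imp_le top_greatest order_le_less_trans)
  then have "\<bar>y - 1 / c\<bar> \<le> v + 1 / c" using assms by (smt (verit) divide_pos_pos)
  then show ?thesis using y by (simp only: abs_diff_ennreal ennreal_leI)
qed

context nodal_asymptotics
begin

lemma empirical_volume_mean_tendsto:
  assumes conc: "nodal_lower_concentration M F c"
  shows "((\<lambda>R. mean_abs_diff M
      (\<lambda>\<omega>. ennreal (measure lborel (ball (0::'a) R)) / nodal_count (path \<omega>) R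
        * indicator {0<..} (nodal_count (path \<omega>) R)) (1 / c)) \<longlongrightarrow> 0) at_top"
proof -
  let ?v = "\<lambda>R. measure lborel (ball (0::'a) R)"
  let ?N = "\<lambda>R \<omega>. nodal_count (path \<omega>) R"
  \<comment> \<open>Concentration with deviation \<open>c / 2\<close>, written
    \<open>c - c / 2\<close> to match the hypothesis. Off \<open>A R\<close> the ratio is at least
    \<open>c / 2\<close>; on \<open>A R\<close> only the crude bound by the volume is
    available.\<close>
  define A where "A R = {\<omega> \<in> space M. enn2ereal (?N R \<omega> / ennreal (?v R)) < ereal (c - c / 2)}" for R
  have A [measurable]: "A R \<in> sets M" for R unfolding A_def by measurable
  define d where "d R = mean_abs_diff M (\<lambda>\<omega>. ?N R \<omega> / ennreal (c * ?v R)) 1" for R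
  have d_lim: "(d \<longlongrightarrow> 0) at_top" unfolding d_def by (rule count_mean_abs_diff_tendsto)
  have bound: "mean_abs_diff M (\<lambda>\<omega>. ennreal (?v R) / ?N R \<omega> * indicator {0<..} (?N R \<omega>)) (1 / c)
      \<le> ennreal (2 / c) * d R + ennreal ((?v R + 1 / c) * prob (A R))" if "0 < R" for R
  proof -
    have v: "0 < ?v R" using that by (rule measure_ball_pos)
    have "mean_abs_diff M (\<lambda>\<omega>. ennreal (?v R) / ?N R \<omega> * indicator {0<..} (?N R \<omega>)) (1 / c)
      \<le> (\<integral>\<^sup>+\<omega>. ennreal (2 / c) * e2ennreal \<bar>enn2ereal (?N R \<omega> / ennreal (c * ?v R)) - ereal 1\<bar> +
            ennreal (?v R + 1 / c) * indicator (A R) \<omega> \<partial>M)"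
      unfolding mean_abs_diff_def
    proof (intro nn_integral_mono)
      fix \<omega> assume \<omega>: "\<omega> \<in> space M"
      show "e2ennreal \<bar>enn2ereal (ennreal (?v R) / ?N R \<omega> * indicator {0<..} (?N R \<omega>)) - ereal (1 / c)\<bar>
        \<le> ennreal (2 / c) * e2ennreal \<bar>enn2ereal (?N R \<omega> / ennreal (c * ?v R)) - ereal 1\<bar> +
            ennreal (?v R + 1 / c) * indicator (A R) \<omega>"
      proof (cases "\<omega> \<in> A R")
        case True
        have "?N R \<omega> = 0 \<or> 1 \<le> ?N R \<omega>"
          using emeasure_count_space_ge_1 unfolding nodal_count_def by (metis zero_less_iff_neq_zero)
        from abs_diff_inverse_count_le'[OF c_pos v this] show ?thesis
          using True by (simp add: add_increasing)
      next
        case False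
        then have "ereal (c / 2) \<le> enn2ereal (?N R \<omega> / ennreal (?v R))"
          using \<omega> by (simp add: A_def not_less)
        then have "e2ennreal (ereal (c / 2)) \<le> e2ennreal (enn2ereal (?N R \<omega> / ennreal (?v R)))"
          by (rule e2ennreal_mono)
        then have "ennreal (c / 2) \<le> ?N R \<omega> / ennreal (?v R)"
          by simp
        from abs_diff_inverse_count_le[OF c_pos v this] show ?thesis
          using False by simp
      qed
    qed
    also have "\<dots> = ennreal (2 / c) * d R + ennreal (?v R + 1 / c) * emeasure M (A R)"
      unfolding d_def mean_abs_diff_def
      by (simp add: nn_integral_add nn_integral_cmult nn_integral_cmult_indicator)
    also have "ennreal (?v R + 1 / c) * emeasure M (A R) = ennreal ((?v R + 1 / c) * prob (A R))"
      using c_pos v by (simp add: emeasure_eq_measure ennreal_mult)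
    finally show ?thesis .
  qed
  have "(\<lambda>R. prob (A R)) \<in> o(\<lambda>R. R powr (- real DIM('a)))"
    using conc[unfolded nodal_lower_concentration_def, rule_format, of "c / 2"] c_pos
    unfolding A_def by simp
  then have lim0: "((\<lambda>R. prob (A R) / R powr (- real DIM('a))) \<longlongrightarrow> 0) at_top"
    by (rule smalloD_tendsto)
  \<comment> \<open>The volume of the ball is a constant times the power \<open>DIM('a)\<close> of
    \<open>R\<close>. Pulling this power out leaves a bounded factor times
    \<open>prob (A R) / R powr (- real DIM('a))\<close>, which tends to 0.\<close>
  have "((\<lambda>R. (unit_ball_vol (real DIM('a)) + 1 / c * R powr (- real DIM('a))) *
      (prob (A R) / R powr (- real DIM('a)))) \<longlongrightarrow> (unit_ball_vol (real DIM('a)) + 1 / c * 0) * 0) at_top"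
    by (intro tendsto_intros lim0 tendsto_neg_powr filterlim_ident) simp
  moreover have "\<forall>\<^sub>F R in at_top. (unit_ball_vol (real DIM('a)) + 1 / c * R powr (- real DIM('a))) *
      (prob (A R) / R powr (- real DIM('a))) = (?v R + 1 / c) * prob (A R)"
    using eventually_gt_at_top[of 0]
  proof eventually_elim
    case (elim R)
    then have "?v R = unit_ball_vol (real DIM('a)) / R powr (- real DIM('a))"
      by (simp add: content_ball powr_minus powr_realpow divide_inverse)
    then show ?case using elim by (simp add: field_simps)
  qed
  ultimately have "((\<lambda>R. (?v R + 1 / c) * prob (A R)) \<longlongrightarrow> 0) at_top"
    by (simp add: Lim_transform_eventually)
  then have "((\<lambda>R. ennreal (2 / c) * d R + ennreal ((?v R + 1 / c) * prob (A R))) \<longlongrightarrow>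
      ennreal (2 / c) * 0 + ennreal 0) at_top"
    by (intro tendsto_add ennreal_tendsto_cmult d_lim tendsto_ennrealI) auto
  then have lim: "((\<lambda>R. ennreal (2 / c) * d R + ennreal ((?v R + 1 / c) * prob (A R))) \<longlongrightarrow> 0) at_top"
    by simp
  show ?thesis
  proof (rule tendsto_sandwich[OF _ _ tendsto_const lim])
    show "\<forall>\<^sub>F R in at_top. mean_abs_diff M
        (\<lambda>\<omega>. ennreal (?v R) / ?N R \<omega> * indicator {0<..} (?N R \<omega>)) (1 / c)
        \<le> ennreal (2 / c) * d R + ennreal ((?v R + 1 / c) * prob (A R))"
      using eventually_gt_at_top[of 0] by eventually_elim (rule bound)
  qed simp
qed

end

section \<open>Nondegeneracy of the field values and conclusion\<close>

lemma centred_gaussian_field_value: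
  assumes "centred_gaussian_field M F"
  shows "centred_gaussian M (F x)"
  using assms[unfolded centred_gaussian_field_def, rule_format, of "{x}" "\<lambda>_. 1"] by simp

text \<open>The spectral measure has total mass 1, so \<open>F x\<close> has second moment 1 and
  cannot vanish almost surely. The remaining alternative is a normal density, which gives no mass to
  0.\<close>

lemma AE_field_nonzero:
  assumes "centred_gaussian_field M F" "spectral_measure M F \<rho>"
  shows "AE \<omega> in M. F x \<omega> \<noteq> 0"
proof -
  have g: "centred_gaussian M (F x)" by (rule centred_gaussian_field_value[OF assms(1)])
  then have [measurable]: "F x \<in> borel_measurable M" by (simp add: centred_gaussian_def)
  interpret R: prob_space \<rho> using assms(2) by (simp add: spectral_measure_def)
  have "complex_of_real (LINT \<omega>|M. F x \<omega> * F x \<omega>) = (LINT l|\<rho>. iexp (2 * pi * (l \<bullet> (x - x))))"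
    using assms(2) unfolding spectral_measure_def by blast
  then have var: "(LINT \<omega>|M. F x \<omega> * F x \<omega>) = 1"
    by (simp add: R.prob_space)
  have "\<not> (AE \<omega> in M. F x \<omega> = 0)"
  proof
    assume "AE \<omega> in M. F x \<omega> = 0"
    then have "(LINT \<omega>|M. F x \<omega> * F x \<omega>) = (LINT \<omega>|M. 0)"
      by (intro integral_cong_AE) auto
    then show False using var by simp
  qed
  then obtain \<sigma> where "distributed M lborel (F x) (normal_density 0 \<sigma>)"
    using g by (auto simp: centred_gaussian_def)
  then have "emeasure M (F x -` {0} \<inter> space M) =
      (\<integral>\<^sup>+y. ennreal (normal_density 0 \<sigma> y) * indicator {0} y \<partial>lborel)"
    by (rule distributed_emeasure) simp
  also have "\<dots> = 0" by (rule nn_integral_null_set) (simp add: null_sets_def)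
  finally show ?thesis
    by (intro AE_I[of _ _ "F x -` {0} \<inter> space M"]) auto
qed

theorem theorem1p5:
  fixes M :: "'w measure"
    and F :: "'a::euclidean_space \<Rightarrow> 'w \<Rightarrow> real"
    and \<rho> :: "'a measure"
    and c_NS :: real
    and \<Psi> :: "real \<Rightarrow> real"
  assumes "DIM('a) \<ge> 2"
    and "prob_space M"
    and "continuous_field M F"
    and "centred_gaussian_field M F"
    and "stationary_field M F"
    and "spectral_measure M F \<rho>"
    and "rho1 \<rho>" and "rho2 \<rho>" and "rho3 \<rho>"
    and "nazarov_sodin_constant M F c_NS" and rho4: "c_NS > 0"
    and "limit_volume_distribution M F c_NS \<Psi>"
  shows "((\<lambda>t. 1 - \<Psi> t) has_integral (1 - percolation_probability M F) * (1 / c_NS)) {0<..} \<and>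
    (nodal_lower_concentration M F c_NS \<longrightarrow>
      ((\<lambda>R. mean_abs_diff M
              (\<lambda>\<omega>. ennreal (measure lborel (ball (0::'a) R)) / nodal_count (\<lambda>x. F x \<omega>) R
                    * indicator {0<..} (nodal_count (\<lambda>x. F x \<omega>) R))
              (1 / c_NS)) \<longlongrightarrow> 0) at_top)"
proof -
  interpret prob_space M by fact
  have "F x \<in> borel_measurable M" for x
    using centred_gaussian_field_value[OF assms(4), of x] by (simp add: centred_gaussian_def)
  then interpret nodal_asymptotics M F c_NS \<Psi>
    using assms by unfold_locales (auto simp: continuous_field_def)
  have "1 - percolation_probability M F = bounded_prob"
    by (rule percolation_probability_eq[OF AE_field_nonzero[OF assms(4,6)]])
  then show ?thesis
    using survival_has_integral empirical_volume_mean_tendsto by simp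
qed

end
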